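(* Let $X=T$ be a compact Lie group (written additively) with its normalized Lebesgue measure $m=p$, and let $Q(t,A)=p(\{s\in T: s+t\in A\})$. Let $\mathbb P$ be the Markov measure on $\Omega=T^{\mathbb N}$ with transition probability $Q$ and initial distribution $p$. Let $f(t,x)=f_0(x)+t$, where $f_0:X\to X$ is any $C^1$ diffeomorphism, let $F$ be the associated skew-product, and let $$\hat P((t,x),B)=\int 1_B(u,f_u(x))\,Q(t,du).$$ Then (a) $F$ satisfies (FPM) with respect to $\mathbb P\times m$; and (b) the operator $\hat P:L^\infty(p\times m)\to L^\infty(p\times m)$, $\hat P\varphi(t,x)=\int\varphi(\hat u)\,\hat P((t,x),d\hat u)$, is eventually compact; namely, with $n_0=2$, $\hat P^{2n_0}=\hat P^4$ is a compact operator.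
   Context: The normalized Lebesgue measure on a compact Lie group is its normalized Haar measure. The Markov measure $\mathbb P$ with transition probability $Q$ and $Q$-stationary initial distribution $p$ (i.e. $p=\int Q(t,\cdot)\,dp(t)$) is the unique shift-invariant probability on $\Omega=T^{\mathbb N}$ with $\mathbb P(A_0\times\dots\times A_{m-1}\times\Omega)=\int_{A_0}\cdots\int_{A_{m-1}}Q(t_{m-2},dt_{m-1})\cdots Q(t_0,dt_1)\,dp(t_0)$. $f_t=f(t,\cdot)$; the skew-product is $F(\omega,x)=(\sigma(\omega),f_{\omega_0}(x))$ on $\Omega\times X$, with $\sigma$ the shift. $\mathbb P$-Markovian measure: an $F$-invariant probability measure $\bar\mu$ on $\Omega\times X$ whose first marginal is $\mathbb P$ and which admits a disintegration $d\bar\mu=\bar\mu_{\omega_0}\,d\mathbb P(\omega)$ (fiber measures depending only on $\omega_0$). (FPM) for $F$ with respect to $\bar m=\mathbb P\times m$: there are finitely many ergodic $F$-invariant probability measures $\bar\mu_1,\dots,\bar\mu_r$ on $\Omega\times X$ such that 1) each $\bar\mu_i$ is $\mathbb P$-Markovian; 2) $\bar\mu_i\ll\bar m$ for each $i$; 3) for every bounded measurable $\varphi:\Omega\times X\to\mathbb R$, $\bar m(B(\bar\mu_1,\varphi)\cup\dots\cup B(\bar\mu_r,\varphi))=1$, where $B(\bar\mu_i,\varphi)=\{(\omega,x):\lim_{n\to\infty}\frac1n\sum_{j=0}^{n-1}\varphi(F^j(\omega,x))=\int\varphi\,d\bar\mu_i\}$. A linear operator $P$ is eventually compact if $P^n$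 is compact for some $n\in\mathbb N$. *)

theory Defs
  imports "HOL-Probability.Probability" "HOL-Probability.Essential_Supremum"
begin

section \<open>Smooth manifolds and Lie groups\<close>

text \<open>
  Charts take values in a linear subspace \<open>E\<close> of a Euclidean space rather than in the whole
  space: Euclidean spaces in HOL-Analysis have positive dimension, and \<open>E = {0}\<close> is needed for
  0-dimensional (finite) Lie groups.  On a relatively open subset \<open>S\<close> of \<open>E\<close> the derivative
  within \<open>S\<close> is unique only in directions of \<open>E\<close>, so only those directional derivatives
  are required to be regular.  For \<open>E = UNIV\<close> this is the usual notion of a \<open>C^k\<close> map.
\<close>

primrec Ck_on :: "nat \<Rightarrow> 'e::euclidean_space set \<Rightarrow> 'e set \<Rightarrow> ('e \<Rightarrow> 'f::euclidean_space) \<Rightarrow> bool" where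
  "Ck_on 0 E S f \<longleftrightarrow> continuous_on S f"
| "Ck_on (Suc k) E S f \<longleftrightarrow>
     (\<exists>D. (\<forall>x\<in>S. (f has_derivative D x) (at x within S)) \<and> (\<forall>v\<in>E. Ck_on k E S (\<lambda>x. D x v)))"

type_synonym ('a, 'e) chart = "'a set \<times> ('a \<Rightarrow> 'e)"

definition smooth_atlas ::
  "'e::euclidean_space set \<Rightarrow> ('a::topological_space, 'e) chart set \<Rightarrow> bool" where
  "smooth_atlas E \<A> \<longleftrightarrow>
     subspace E \<and>
     (\<Union>(U, \<phi>)\<in>\<A>. U) = UNIV \<and>
     (\<forall>(U, \<phi>)\<in>\<A>. open U \<and> openin (top_of_set E) (\<phi> ` U) \<and>
        homeomorphism U (\<phi> ` U) \<phi> (inv_into U \<phi>)) \<and>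
     (\<forall>(U, \<phi>)\<in>\<A>. \<forall>(V, \<psi>)\<in>\<A>. \<forall>k. Ck_on k E (\<phi> ` (U \<inter> V)) (\<psi> \<circ> inv_into U \<phi>))"

definition Ck_map ::
  "nat \<Rightarrow> 'e::euclidean_space set \<Rightarrow> ('a::topological_space, 'e) chart set \<Rightarrow>
   ('b::topological_space, 'f::euclidean_space) chart set \<Rightarrow> ('a \<Rightarrow> 'b) \<Rightarrow> bool" where
  "Ck_map k E \<A> \<B> g \<longleftrightarrow>
     continuous_on UNIV g \<and>
     (\<forall>(U, \<phi>)\<in>\<A>. \<forall>(V, \<psi>)\<in>\<B>. Ck_on k E (\<phi> ` (U \<inter> g -` V)) (\<psi> \<circ> g \<circ> inv_into U \<phi>))"

definition prod_atlas :: "('a, 'e) chart set \<Rightarrow> ('b, 'f) chart set \<Rightarrow> ('a \<times> 'b, 'e \<times> 'f) chart set" where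
  "prod_atlas \<A> \<B> = {(U \<times> V, map_prod \<phi> \<psi>) | U \<phi> V \<psi>. (U, \<phi>) \<in> \<A> \<and> (V, \<psi>) \<in> \<B>}"

text \<open>
  The group is the whole type, written additively; the class \<open>topological_group_add\<close> does not
  assume commutativity.
\<close>

definition lie_group ::
  "'e::euclidean_space set \<Rightarrow>
   ('a::{topological_group_add, t2_space, second_countable_topology}, 'e) chart set \<Rightarrow> bool" where
  "lie_group E \<A> \<longleftrightarrow>
     smooth_atlas E \<A> \<and>
     (\<forall>k. Ck_map k (E \<times> E) (prod_atlas \<A> \<A>) \<A> (\<lambda>(x, y). x + y)) \<and>
     (\<forall>k. Ck_map k E \<A> \<A> uminus)"

definition compact_lie_group ::
  "'e::euclidean_space set \<Rightarrow>
   ('a::{topological_group_add, t2_space, second_countable_topology}, 'e) chart set \<Rightarrow> bool" where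
  "compact_lie_group E \<A> \<longleftrightarrow> lie_group E \<A> \<and> compact (UNIV :: 'a set)"

definition C1_diffeomorphism ::
  "'e::euclidean_space set \<Rightarrow> ('a::topological_space, 'e) chart set \<Rightarrow> ('a \<Rightarrow> 'a) \<Rightarrow> bool" where
  "C1_diffeomorphism E \<A> g \<longleftrightarrow> bij g \<and> Ck_map 1 E \<A> \<A> g \<and> Ck_map 1 E \<A> \<A> (inv g)"

text \<open>
  Regularity need not be required, since finite Borel measures on compact metrizable spaces are
  regular.  Right invariance is a theorem for compact groups.
\<close>

definition normalized_haar :: "'a::topological_group_add measure \<Rightarrow> bool" where
  "normalized_haar p \<longleftrightarrow>
     prob_space p \<and> sets p = sets borel \<and>
     (\<forall>a. \<forall>A\<in>sets borel. emeasure p ((+) a ` A) = emeasure p A)"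

section \<open>Markov measures and skew-products\<close>

abbreviation path_algebra :: "(nat \<Rightarrow> 't::topological_space) measure" where
  "path_algebra \<equiv> Pi\<^sub>M UNIV (\<lambda>_. borel)"

definition shift :: "(nat \<Rightarrow> 't) \<Rightarrow> nat \<Rightarrow> 't" where
  "shift \<omega> = (\<lambda>n. \<omega> (Suc n))"

text \<open>
  \<open>path_prob Q [A\<^sub>1, \<dots>, A\<^sub>k] t\<close> is the iterated integral
  of \<open>Q(t\<^sub>k\<^sub>-\<^sub>1, dt\<^sub>k) \<dots> Q(t, dt\<^sub>1)\<close> over \<open>A\<^sub>1, \<dots>, A\<^sub>k\<close>.
\<close>

primrec path_prob :: "('t \<Rightarrow> 't measure) \<Rightarrow> 't set list \<Rightarrow> 't \<Rightarrow> ennreal" where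
  "path_prob Q [] t = 1"
| "path_prob Q (A # As) t = (\<integral>\<^sup>+u\<in>A. path_prob Q As u \<partial>Q t)"

definition markov_measure ::
  "('t::topological_space \<Rightarrow> 't measure) \<Rightarrow> 't measure \<Rightarrow> (nat \<Rightarrow> 't) measure \<Rightarrow> bool" where
  "markov_measure Q p P \<longleftrightarrow>
     prob_space P \<and> sets P = sets path_algebra \<and>
     distr P path_algebra shift = P \<and>
     (\<forall>A As. set (A # As) \<subseteq> sets borel \<longrightarrow>
        emeasure P {\<omega>. \<forall>i<length (A # As). \<omega> i \<in> (A # As) ! i} =
        (\<integral>\<^sup>+t\<in>A. path_prob Q As t \<partial>p))"

definition skew_product :: "('t \<Rightarrow> 'x \<Rightarrow> 'x) \<Rightarrow> (nat \<Rightarrow> 't) \<times> 'x \<Rightarrow> (nat \<Rightarrow> 't) \<times> 'x" where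
  "skew_product f = (\<lambda>(\<omega>, x). (shift \<omega>, f (\<omega> 0) x))"

definition invariant_prob :: "('z \<Rightarrow> 'z) \<Rightarrow> 'z measure \<Rightarrow> bool" where
  "invariant_prob F \<mu> \<longleftrightarrow> prob_space \<mu> \<and> F \<in> measurable \<mu> \<mu> \<and> distr \<mu> \<mu> F = \<mu>"

definition ergodic_prob :: "('z \<Rightarrow> 'z) \<Rightarrow> 'z measure \<Rightarrow> bool" where
  "ergodic_prob F \<mu> \<longleftrightarrow> invariant_prob F \<mu> \<and>
     (\<forall>A\<in>sets \<mu>. F -` A \<inter> space \<mu> = A \<longrightarrow> measure \<mu> A = 0 \<or> measure \<mu> A = 1)"

definition markovian ::
  "('t::topological_space \<Rightarrow> 'x::topological_space \<Rightarrow> 'x) \<Rightarrow> (nat \<Rightarrow> 't) measure \<Rightarrow>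
   ((nat \<Rightarrow> 't) \<times> 'x) measure \<Rightarrow> bool" where
  "markovian f P \<mu> \<longleftrightarrow>
     sets \<mu> = sets (path_algebra \<Otimes>\<^sub>M borel) \<and>
     invariant_prob (skew_product f) \<mu> \<and>
     distr \<mu> path_algebra fst = P \<and>
     (\<exists>\<kappa>. \<kappa> \<in> measurable borel (prob_algebra borel) \<and>
        (\<forall>A\<in>sets (path_algebra \<Otimes>\<^sub>M borel).
           emeasure \<mu> A = (\<integral>\<^sup>+\<omega>. emeasure (\<kappa> (\<omega> 0)) {x. (\<omega>, x) \<in> A} \<partial>P)))"

definition birkhoff_basin :: "('z \<Rightarrow> 'z) \<Rightarrow> 'z measure \<Rightarrow> ('z \<Rightarrow> real) \<Rightarrow> 'z set" where
  "birkhoff_basin F \<mu> \<phi> =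
     {z. (\<lambda>n. (\<Sum>j<n. \<phi> ((F ^^ j) z)) / real n) \<longlonglongrightarrow> (\<integral>z. \<phi> z \<partial>\<mu>)}"

definition FPM ::
  "('t::topological_space \<Rightarrow> 'x::topological_space \<Rightarrow> 'x) \<Rightarrow> (nat \<Rightarrow> 't) measure \<Rightarrow>
   'x measure \<Rightarrow> bool" where
  "FPM f P m \<longleftrightarrow>
     (\<exists>(r::nat) \<mu>.
        (\<forall>i<r. ergodic_prob (skew_product f) (\<mu> i) \<and>
               markovian f P (\<mu> i) \<and>
               absolutely_continuous (P \<Otimes>\<^sub>M m) (\<mu> i)) \<and>
        (\<forall>\<phi>\<in>borel_measurable (P \<Otimes>\<^sub>M m). (\<exists>C. \<forall>z. \<bar>\<phi> z\<bar> \<le> C) \<longrightarrow>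
           emeasure (P \<Otimes>\<^sub>M m) (\<Union>i<r. birkhoff_basin (skew_product f) (\<mu> i) \<phi>) = 1))"

definition hat_kernel ::
  "('t::topological_space \<Rightarrow> 't measure) \<Rightarrow> ('t \<Rightarrow> 'x::topological_space \<Rightarrow> 'x) \<Rightarrow>
   't \<times> 'x \<Rightarrow> ('t \<times> 'x) measure" where
  "hat_kernel Q f = (\<lambda>(t, x). distr (Q t) (borel \<Otimes>\<^sub>M borel) (\<lambda>u. (u, f u x)))"

definition kernel_op :: "('z \<Rightarrow> 'z measure) \<Rightarrow> ('z \<Rightarrow> real) \<Rightarrow> 'z \<Rightarrow> real" where
  "kernel_op K \<phi> z = (\<integral>w. \<phi> w \<partial>K z)"

section \<open>Operators on real \<open>L\<^sup>\<infinity>\<close>\<close>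

definition Linf_fun :: "'z measure \<Rightarrow> ('z \<Rightarrow> real) set" where
  "Linf_fun M = {\<phi> \<in> borel_measurable M. \<exists>C. AE z in M. \<bar>\<phi> z\<bar> \<le> C}"

definition Linf_rel :: "'z measure \<Rightarrow> (('z \<Rightarrow> real) \<times> ('z \<Rightarrow> real)) set" where
  "Linf_rel M = {(\<phi>, \<psi>). \<phi> \<in> Linf_fun M \<and> \<psi> \<in> Linf_fun M \<and> (AE z in M. \<phi> z = \<psi> z)}"

definition Linf :: "'z measure \<Rightarrow> ('z \<Rightarrow> real) set set" where
  "Linf M = Linf_fun M // Linf_rel M"

definition Linf_dist :: "'z measure \<Rightarrow> ('z \<Rightarrow> real) set \<Rightarrow> ('z \<Rightarrow> real) set \<Rightarrow> real" where
  "Linf_dist M c d =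
     real_of_ereal (esssup M (\<lambda>z. ereal \<bar>(SOME \<phi>. \<phi> \<in> c) z - (SOME \<psi>. \<psi> \<in> d) z\<bar>))"

lemma Linf_rep: assumes "c \<in> Linf M" shows "(SOME f. f \<in> c) \<in> c" "c \<subseteq> Linf_fun M"
  "f \<in> c \<Longrightarrow> g \<in> Linf_fun M \<Longrightarrow> (AE z in M. f z = g z) \<longleftrightarrow> g \<in> c"
proof -
  obtain h where h: "h \<in> Linf_fun M" "c = Linf_rel M `` {h}"
    using assms by (auto simp: Linf_def quotient_def)
  have "h \<in> c" using h by (auto simp: Linf_rel_def)
  then show "(SOME f. f \<in> c) \<in> c" by (rule someI[where P = "\<lambda>f. f \<in> c"])
  show "c \<subseteq> Linf_fun M" using h by (auto simp: Linf_rel_def)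
  show "f \<in> c \<Longrightarrow> g \<in> Linf_fun M \<Longrightarrow> (AE z in M. f z = g z) \<longleftrightarrow> g \<in> c"
    using h unfolding Linf_rel_def by (auto elim: eventually_elim2)
qed

lemma Linf_esssup_diff: assumes "f \<in> Linf_fun M" "g \<in> Linf_fun M" "emeasure M (space M) \<noteq> 0"
  shows "\<exists>r\<ge>0. esssup M (\<lambda>z. ereal \<bar>f z - g z\<bar>) = ereal r \<and> (AE z in M. \<bar>f z - g z\<bar> \<le> r)"
proof -
  let ?h = "\<lambda>z. ereal \<bar>f z - g z\<bar>"
  have m: "?h \<in> borel_measurable M" using assms by (auto simp: Linf_fun_def)
  obtain C D where C: "AE z in M. \<bar>f z\<bar> \<le> C" "AE z in M. \<bar>g z\<bar> \<le> D" using assms by (auto simp: Linf_fun_def)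
  have "AE z in M. ?h z \<le> ereal (C + D)" using C by (eventually_elim) auto
  then have "esssup M ?h \<le> ereal (C+D)" using m by (intro esssup_I)
  moreover have "0 \<le> esssup M ?h"
    using esssup_mono[of "\<lambda>_. 0::ereal" M ?h] esssup_const[OF assms(3), of "0::ereal"] by simp
  ultimately obtain r where r: "esssup M ?h = ereal r" "0 \<le> r" by (cases "esssup M ?h") auto
  then show ?thesis using esssup_AE[of ?h M] by auto
qed

lemma Metric_space_Linf: "prob_space M \<Longrightarrow> Metric_space (Linf M) (Linf_dist M)"
proof -
  assume M: "prob_space M"
  then have ne: "emeasure M (space M) \<noteq> 0" by (simp add: prob_space.emeasure_space_1)
  show ?thesis
  proof
    fix c d show "0 \<le> Linf_dist M c d"
    proof -
      have "0 \<le> esssup M (\<lambda>z. ereal \<bar>(SOME f. f \<in> c) z - (SOME f. f \<in> d) z\<bar>)"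
      using esssup_mono[of "\<lambda>_. 0::ereal" M "\<lambda>z. ereal \<bar>(SOME f. f \<in> c) z - (SOME f. f \<in> d) z\<bar>"] esssup_const[OF ne, of "0::ereal"] by simp
      then show ?thesis by (simp add: Linf_dist_def real_of_ereal_pos)
    qed
    show "Linf_dist M c d = Linf_dist M d c" by (simp add: Linf_dist_def abs_minus_commute)
  next
    fix c d assume cd: "c \<in> Linf M" "d \<in> Linf M"
    let ?f = "SOME f. f \<in> c" let ?g = "SOME f. f \<in> d"
    have L: "?f \<in> Linf_fun M" "?g \<in> Linf_fun M" "?f \<in> c" "?g \<in> d" using Linf_rep cd by blast+
    obtain r where r: "esssup M (\<lambda>z. ereal \<bar>?f z - ?g z\<bar>) = ereal r" "(AE z in M. \<bar>?f z - ?g z\<bar> \<le> r)"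
      using Linf_esssup_diff[OF L(1,2) ne] by auto
    show "(Linf_dist M c d = 0) = (c = d)"
    proof
      assume "Linf_dist M c d = 0"
      then have "AE z in M. ?f z = ?g z" using r by (auto simp: Linf_dist_def)
      then have a: "?g \<in> c" using Linf_rep(3)[OF cd(1) L(3) L(2)] by simp
      show "c = d" using Linf_rep(3)[OF cd(1) a] Linf_rep(3)[OF cd(2) L(4)] Linf_rep(2)[OF cd(1)] Linf_rep(2)[OF cd(2)] by blast
    next
      assume "c = d" then show "Linf_dist M c d = 0" using esssup_const[OF ne, of "0::ereal"] by (simp add: Linf_dist_def zero_ereal_def)
    qed
  next
    fix c d e assume cd: "c \<in> Linf M" "d \<in> Linf M" "e \<in> Linf M"
    let ?f = "SOME f. f \<in> c" let ?g = "SOME f. f \<in> d" let ?h = "SOME f. f \<in> e"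
    have L: "?f \<in> Linf_fun M" "?g \<in> Linf_fun M" "?h \<in> Linf_fun M" using Linf_rep cd by blast+
    obtain r where r: "esssup M (\<lambda>z. ereal \<bar>?f z - ?g z\<bar>) = ereal r" "(AE z in M. \<bar>?f z - ?g z\<bar> \<le> r)"
      using Linf_esssup_diff[OF L(1,2) ne] by auto
    obtain s where s: "esssup M (\<lambda>z. ereal \<bar>?g z - ?h z\<bar>) = ereal s" "(AE z in M. \<bar>?g z - ?h z\<bar> \<le> s)"
      using Linf_esssup_diff[OF L(2,3) ne] by auto
    obtain t where t: "esssup M (\<lambda>z. ereal \<bar>?f z - ?h z\<bar>) = ereal t" 
      using Linf_esssup_diff[OF L(1,3) ne] by auto
    have "AE z in M. ereal \<bar>?f z - ?h z\<bar> \<le> ereal (r + s)" using r(2) s(2) by eventually_elim auto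
    then have "esssup M (\<lambda>z. ereal \<bar>?f z - ?h z\<bar>) \<le> ereal (r + s)"
      using L by (intro esssup_I) (auto simp: Linf_fun_def)
    then show "Linf_dist M c e \<le> Linf_dist M c d + Linf_dist M d e" using r s t by (simp add: Linf_dist_def)
  qed
qed

definition Linf_add ::
  "'z measure \<Rightarrow> ('z \<Rightarrow> real) set \<Rightarrow> ('z \<Rightarrow> real) set \<Rightarrow> ('z \<Rightarrow> real) set" where
  "Linf_add M c d = (\<Union>\<phi>\<in>c. \<Union>\<psi>\<in>d. Linf_rel M `` {\<lambda>z. \<phi> z + \<psi> z})"

definition Linf_scale :: "'z measure \<Rightarrow> real \<Rightarrow> ('z \<Rightarrow> real) set \<Rightarrow> ('z \<Rightarrow> real) set" where
  "Linf_scale M a c = (\<Union>\<phi>\<in>c. Linf_rel M `` {\<lambda>z. a * \<phi> z})"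

definition Linf_linear :: "'z measure \<Rightarrow> (('z \<Rightarrow> real) set \<Rightarrow> ('z \<Rightarrow> real) set) \<Rightarrow> bool" where
  "Linf_linear M L \<longleftrightarrow>
     (\<forall>c\<in>Linf M. L c \<in> Linf M) \<and>
     (\<forall>c\<in>Linf M. \<forall>d\<in>Linf M. L (Linf_add M c d) = Linf_add M (L c) (L d)) \<and>
     (\<forall>a. \<forall>c\<in>Linf M. L (Linf_scale M a c) = Linf_scale M a (L c))"

definition Linf_compact_op :: "'z measure \<Rightarrow> (('z \<Rightarrow> real) set \<Rightarrow> ('z \<Rightarrow> real) set) \<Rightarrow> bool" where
  "Linf_compact_op M L \<longleftrightarrow> Linf_linear M L \<and>
     (\<forall>B. Metric_space.mbounded (Linf M) (Linf_dist M) B \<longrightarrow>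
        compactin (Metric_space.mtopology (Linf M) (Linf_dist M))
          (Metric_space.mtopology (Linf M) (Linf_dist M) closure_of (L ` B)))"

definition Linf_eventually_compact ::
  "'z measure \<Rightarrow> (('z \<Rightarrow> real) set \<Rightarrow> ('z \<Rightarrow> real) set) \<Rightarrow> bool" where
  "Linf_eventually_compact M L \<longleftrightarrow> Linf_linear M L \<and> (\<exists>n\<ge>1. Linf_compact_op M (L ^^ n))"

text \<open>
  \<open>Linf_lift M T\<close> is the operator on classes induced by an operator \<open>T\<close> on functions; this
  makes sense when \<open>Linf_respects M T\<close>, i.e. when \<open>T\<close> preserves \<open>Linf_fun M\<close> and equality a.e.
\<close>

definition Linf_respects :: "'z measure \<Rightarrow> (('z \<Rightarrow> real) \<Rightarrow> ('z \<Rightarrow> real)) \<Rightarrow> bool" where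
  "Linf_respects M T \<longleftrightarrow> (\<forall>\<phi> \<psi>. (\<phi>, \<psi>) \<in> Linf_rel M \<longrightarrow> (T \<phi>, T \<psi>) \<in> Linf_rel M)"

definition Linf_lift ::
  "'z measure \<Rightarrow> (('z \<Rightarrow> real) \<Rightarrow> ('z \<Rightarrow> real)) \<Rightarrow> ('z \<Rightarrow> real) set \<Rightarrow> ('z \<Rightarrow> real) set" where
  "Linf_lift M T c = (\<Union>\<phi>\<in>c. Linf_rel M `` {T \<phi>})"

end

theory Submission
  imports Defs
begin

text \<open>
  A left-invariant probability \<open>p\<close> on a compact group is also right-invariant
  (\<open>haar_right_distr\<close>), so \<open>Q(t, \<cdot>) = p\<close> for every \<open>t\<close>.  Hence the letters
  \<open>\<omega>\<^sub>0, \<omega>\<^sub>1, \<dots>\<close> are independent with law \<open>p\<close> (\<open>markov_measure_iid\<close>), and everything is about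
  the random translations \<open>x \<mapsto> f\<^sub>0(x) + \<omega>\<^sub>n\<close>.

  \<^bold>\<open>Physical measures.\<close>  Let \<open>x\<^sub>0 = x\<close> and \<open>x\<^sub>n\<^sub>+\<^sub>1 = f\<^sub>0(x\<^sub>n) + \<omega>\<^sub>n\<close>.  Given the past, \<open>x\<^sub>n\<^sub>+\<^sub>1\<close> is a
  translate of a uniform letter, so the positions \<open>x\<^sub>0, x\<^sub>1, \<dots>\<close> are again independent with law
  \<open>p\<close>; and they determine the letters, as \<open>\<omega>\<^sub>n = - f\<^sub>0(x\<^sub>n) + x\<^sub>n\<^sub>+\<^sub>1\<close>.  Reading the letters off the
  positions therefore carries the one-sided Bernoulli shift on the positions to the skew-product
  with the measure \<open>P \<times> p\<close> (\<open>distr_orbit_coding\<close>).  The shift is ergodic, so \<open>P \<times> p\<close> is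
  ergodic for the skew-product, and this single measure serves: Birkhoff's theorem
  (\<open>ergodic_bounded_birkhoff\<close>) gives its basins full measure.

  \<^bold>\<open>Compactness.\<close>  The function \<open>\<phi>\<close> is sent by the transition operator to
  \<open>(t, x) \<mapsto> \<integral> \<phi>(u, f\<^sub>0(x) + u) dp(u)\<close>, which depends on \<open>x\<close> only.  Applying the operator again
  averages this over the uniformly distributed point \<open>f\<^sub>0(x) + u\<close>, so the square of the operator
  has values in the constant functions (\<open>transition_twice\<close>).  The fourth power is then a bounded
  operator of rank one, hence compact (\<open>Linf_compact_op_constants\<close>).

  The smooth structure enters when the operator is to act on classes modulo null sets.  If
  \<open>\<phi>\<close> is the indicator of \<open>{(u, v). v - u \<in> K}\<close>, its image is the indicator of
  \<open>f\<^sub>0 -` K\<close>, so preimages under \<open>f\<^sub>0\<close> of Haar-null sets must be null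
  (\<open>lie_group_C1_diffeomorphism_vimage_null\<close>).  Differentiable maps preserve Lebesgue-null sets
  in charts, and a Fubini argument on Lebesgue measure times \<open>p\<close>, with the right translations as
  intermediaries, shows that being Haar-null and being Lebesgue-null in all charts are the same
  (\<open>haar_null_iff_translates_chart_null\<close>).
\<close>

section \<open>Invariance of the Haar probability\<close>

lemma haar_prob_space: "normalized_haar p \<Longrightarrow> prob_space p"
  by (simp add: normalized_haar_def)

lemma sets_haar: "normalized_haar p \<Longrightarrow> sets p = sets borel"
  by (simp add: normalized_haar_def)

lemma space_haar: "normalized_haar p \<Longrightarrow> space p = UNIV"
  using sets_eq_imp_space_eq[OF sets_haar] by simp

lemma borel_measurable_uminus_group:
  "(uminus :: 'a::topological_group_add \<Rightarrow> 'a) \<in> borel_measurable borel"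
  by (intro borel_measurable_continuous_onI continuous_intros)

lemma haar_left_distr:
  fixes p :: "'a::topological_group_add measure"
  assumes "normalized_haar p"
  shows "distr p p (\<lambda>x. a + x) = p"
proof (rule measure_eqI)
  note s = sets_haar[OF assms] and sp = space_haar[OF assms]
  have m: "(\<lambda>x. a + x) \<in> measurable p p"
    unfolding measurable_cong_sets[OF s s]
    by (intro borel_measurable_continuous_onI continuous_intros)
  fix A assume "A \<in> sets (distr p p (\<lambda>x. a + x))"
  then have A: "A \<in> sets borel" using s by simp
  have "(\<lambda>x. a + x) -` A = (+) (- a) ` A"
    by (auto simp: image_iff) (metis add.assoc add.right_inverse add_0 add.left_inverse)+
  then show "emeasure (distr p p (\<lambda>x. a + x)) A = emeasure p A"
    using assms A s sp m by (simp add: emeasure_distr normalized_haar_def)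
qed simp

lemma haar_right_measurable:
  fixes p :: "'a::topological_group_add measure"
  assumes "normalized_haar p"
  shows "(\<lambda>x. x + a) \<in> measurable p p"
  unfolding measurable_cong_sets[OF sets_haar[OF assms] sets_haar[OF assms]]
  by (intro borel_measurable_continuous_onI continuous_intros)

text \<open>
  Integrating \<open>1\<^sub>A(- x + y)\<close> over \<open>y\<close> first gives \<open>p(A)\<close>; integrating over \<open>x\<close> first, after
  rewriting \<open>- x + y = - (- y + x)\<close>, gives \<open>p(- A)\<close>.  So \<open>p\<close> is invariant under \<open>x \<mapsto> - x\<close>,
  which exchanges left and right translations.
\<close>

lemma haar_right_distr:
  fixes p :: "'a::{topological_group_add, second_countable_topology} measure"
  assumes "normalized_haar p"
  shows "distr p p (\<lambda>x. x + a) = p"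
proof -
  note s[measurable_cong] = sets_haar[OF assms] and sp = space_haar[OF assms] and pr = haar_prob_space[OF assms]
  interpret prob_space p by fact
  interpret pair_prob_space p p ..
  note borel_measurable_uminus_group[measurable]
  have inv: "emeasure p (uminus -` A) = emeasure p A" if [measurable]: "A \<in> sets borel" for A
  proof -
    have "emeasure p A = (\<integral>\<^sup>+x. \<integral>\<^sup>+y. indicator A (- x + y) \<partial>p \<partial>p)"
    proof -
      have "(\<integral>\<^sup>+y. indicator A (- x + y) \<partial>p) = emeasure p A" for x
      proof -
        have "(\<integral>\<^sup>+y. indicator A (- x + y) \<partial>p) = (\<integral>\<^sup>+y. indicator A y \<partial>distr p p (\<lambda>y. - x + y))"
          by (subst nn_integral_distr) auto
        then show ?thesis by (simp add: haar_left_distr[OF assms] s)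
      qed
      then show ?thesis by (simp add: prob_space.emeasure_space_1[OF pr])
    qed
    also have "\<dots> = (\<integral>\<^sup>+y. \<integral>\<^sup>+x. indicator A (- x + y) \<partial>p \<partial>p)"
      by (rule Fubini'[symmetric]) simp
    also have "\<dots> = (\<integral>\<^sup>+y. emeasure p (uminus -` A) \<partial>p)"
    proof (rule nn_integral_cong)
      fix y
      have "(\<integral>\<^sup>+x. indicator A (- x + y) \<partial>p) =
          (\<integral>\<^sup>+x. indicator A (- x) \<partial>distr p p (\<lambda>x. - y + x))"
        by (subst nn_integral_distr) (auto simp: minus_add)
      also have "\<dots> = (\<integral>\<^sup>+x. indicator (uminus -` A) x \<partial>p)"
        by (simp add: haar_left_distr[OF assms] indicator_def)
      also have "\<dots> = emeasure p (uminus -` A)"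
        using measurable_sets[OF borel_measurable_uminus_group that] s by simp
      finally show "(\<integral>\<^sup>+x. indicator A (- x + y) \<partial>p) = emeasure p (uminus -` A)" .
    qed
    finally show ?thesis by (simp add: prob_space.emeasure_space_1[OF pr])
  qed
  show ?thesis
  proof (rule measure_eqI)
    fix A assume "A \<in> sets (distr p p (\<lambda>x. x + a))"
    then have A[measurable]: "A \<in> sets borel" using s by simp
    have r: "(\<lambda>x. x + a) -` A \<in> sets borel" 
      using measurable_sets[of "\<lambda>x. x + a" borel borel A] by simp
    have "emeasure (distr p p (\<lambda>x. x + a)) A = emeasure p ((\<lambda>x. x + a) -` A)"
      using s sp by (subst emeasure_distr) auto
    also have "\<dots> = emeasure p (uminus -` (\<lambda>x. x + a) -` A)" using inv[OF r] by simp
    also have "uminus -` (\<lambda>x. x + a) -` A = (\<lambda>x. - a + x) -` uminus -` A"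
      by (auto simp: minus_add)
    also have "emeasure p \<dots> = emeasure (distr p p (\<lambda>x. - a + x)) (uminus -` A)"
      using s sp measurable_sets[OF borel_measurable_uminus_group A] by (subst emeasure_distr) auto
    also have "\<dots> = emeasure p A" by (simp add: haar_left_distr[OF assms] inv)
    finally show "emeasure (distr p p (\<lambda>x. x + a)) A = emeasure p A" .
  qed simp
qed

section \<open>Null sets in charts\<close>

text \<open>
  Charts map into a subspace \<open>E\<close> which may be Lebesgue-null itself.  The map \<open>\<pi>\<close> is meant to be a
  linear retraction onto \<open>E\<close>: the preimage under \<open>\<pi>\<close> of a subset of \<open>E\<close> is the cylinder over it in
  the whole space, and it is negligible exactly if the subset is null for the Lebesgue measure of
  \<open>E\<close>.
\<close>

definition chart_null ::
  "('e::euclidean_space \<Rightarrow> 'e) \<Rightarrow> ('a, 'e) chart set \<Rightarrow> 'a set \<Rightarrow> bool" where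
  "chart_null \<pi> \<A> N \<longleftrightarrow> (\<forall>(U, \<phi>)\<in>\<A>. negligible (\<pi> -` \<phi> ` (N \<inter> U)))"

definition chart_differentiable ::
  "('a::topological_space, 'e::euclidean_space) chart set \<Rightarrow> ('a \<Rightarrow> 'a) \<Rightarrow> bool" where
  "chart_differentiable \<A> g \<longleftrightarrow>
     (\<forall>(U, \<phi>)\<in>\<A>. \<forall>(V, \<psi>)\<in>\<A>.
        (\<psi> \<circ> g \<circ> inv_into U \<phi>) differentiable_on \<phi> ` (U \<inter> g -` V))"

lemma smooth_atlasD:
  assumes "smooth_atlas E \<A>" "(U, \<phi>) \<in> \<A>"
  shows "open U" "openin (top_of_set E) (\<phi> ` U)" "continuous_on (\<phi> ` U) (inv_into U \<phi>)"
    "inj_on \<phi> U" "\<phi> ` U \<subseteq> E"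
proof -
  have "\<forall>(U, \<phi>)\<in>\<A>. open U \<and> openin (top_of_set E) (\<phi> ` U) \<and>
      homeomorphism U (\<phi> ` U) \<phi> (inv_into U \<phi>)"
    using assms(1) unfolding smooth_atlas_def by (elim conjE)
  with assms(2) have *: "open U" "openin (top_of_set E) (\<phi> ` U)"
      "homeomorphism U (\<phi> ` U) \<phi> (inv_into U \<phi>)"
    by fastforce+
  show "open U" "openin (top_of_set E) (\<phi> ` U)" by fact+
  show "\<phi> ` U \<subseteq> E" using openin_imp_subset[OF *(2)] .
  show "continuous_on (\<phi> ` U) (inv_into U \<phi>)" "inj_on \<phi> U"
    using *(3) unfolding homeomorphism_def by (auto intro: inj_on_inverseI)
qed

lemma smooth_atlas_cover:
  assumes "smooth_atlas E \<A>"
  obtains U \<phi> where "(U, \<phi>) \<in> \<A>" "x \<in> U"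
proof -
  have "(\<Union>(U, \<phi>)\<in>\<A>. U) = UNIV" using assms unfolding smooth_atlas_def by (elim conjE)
  then have "x \<in> (\<Union>(U, \<phi>)\<in>\<A>. U)" by simp
  then show ?thesis using that by auto
qed

text \<open>
  A chart expression \<open>h\<close> of \<open>g\<close> is defined on part of \<open>E\<close>.  It extends to cylinders by
  \<open>w \<mapsto> h(\<pi> w) + (w - \<pi> w)\<close>, the identity along the fibres of \<open>\<pi>\<close>, which is a differentiable map
  between spaces of equal dimension and so preserves negligible sets.  Countability of the atlas
  lets these pieces be put together.
\<close>

lemma chart_null_image:
  fixes \<A> :: "('a::topological_space, 'e::euclidean_space) chart set"
  assumes at: "smooth_atlas E \<A>" and cnt: "countable \<A>"
    and \<pi>: "linear \<pi>" "\<forall>v\<in>E. \<pi> v = v" "range \<pi> \<subseteq> E"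
    and g: "chart_differentiable \<A> g" and N: "chart_null \<pi> \<A> N"
  shows "chart_null \<pi> \<A> (g ` N)"
  unfolding chart_null_def
proof safe
  fix V \<psi> assume V: "(V, \<psi>) \<in> \<A>"
  define h :: "('a, 'e) chart \<Rightarrow> 'e \<Rightarrow> 'e" where "h = (\<lambda>(U, \<phi>). \<psi> \<circ> g \<circ> inv_into U \<phi>)"
  define G :: "('a, 'e) chart \<Rightarrow> 'e \<Rightarrow> 'e" where "G c w = h c (\<pi> w) + (w - \<pi> w)" for c w
  define Z :: "('a, 'e) chart \<Rightarrow> 'e set" where "Z = (\<lambda>(U, \<phi>). \<pi> -` \<phi> ` (N \<inter> (U \<inter> g -` V)))"
  have neg: "negligible (G c ` Z c)" if c: "c \<in> \<A>" for c
  proof -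
    obtain U \<phi> where [simp]: "c = (U, \<phi>)" by (cases c)
    have "Z c \<subseteq> \<pi> -` \<phi> ` (N \<inter> U)" by (auto simp: Z_def)
    then have "negligible (Z c)" using N c by (auto simp: chart_null_def intro: negligible_subset)
    moreover have "G c differentiable_on Z c"
    proof -
      have "h c differentiable_on \<phi> ` (U \<inter> g -` V)"
        using g V c by (auto simp: chart_differentiable_def h_def)
      then have "h c differentiable_on \<pi> ` Z c"
        by (rule differentiable_on_subset) (auto simp: Z_def)
      then have "(\<lambda>w. h c (\<pi> w)) differentiable_on Z c"
        by (rule differentiable_on_compose[OF linear_imp_differentiable_on[OF \<pi>(1)]])
      then show ?thesis unfolding G_def
        using linear_imp_differentiable_on[OF \<pi>(1)] differentiable_on_id[unfolded id_def]
        by (intro differentiable_on_add differentiable_on_diff)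
    qed
    ultimately show ?thesis by (rule negligible_differentiable_image_negligible[OF order_refl])
  qed
  have "\<pi> -` \<psi> ` (g ` N \<inter> V) \<subseteq> (\<Union>c\<in>\<A>. G c ` Z c)"
  proof
    fix v assume "v \<in> \<pi> -` \<psi> ` (g ` N \<inter> V)"
    then obtain x where x: "x \<in> N" "g x \<in> V" "\<pi> v = \<psi> (g x)" by auto
    obtain U \<phi> where c: "(U, \<phi>) \<in> \<A>" "x \<in> U" by (rule smooth_atlas_cover[OF at])
    \<comment> \<open>the point of the cylinder over \<open>\<phi> x\<close> in the same position along the fibre as \<open>v\<close>\<close>
    define w where "w = \<phi> x + (v - \<pi> v)"
    have \<pi>w: "\<pi> w = \<phi> x"
    proof -
      have "\<pi> (\<phi> x) = \<phi> x" using smooth_atlasD(5)[OF at c(1)] c(2) \<pi>(2) by auto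
      moreover have "\<pi> (\<pi> v) = \<pi> v" using \<pi>(2,3) by auto
      ultimately show ?thesis by (simp add: w_def linear_add[OF \<pi>(1)] linear_diff[OF \<pi>(1)])
    qed
    then have "w \<in> Z (U, \<phi>)" using x c by (auto simp: Z_def)
    moreover have "G (U, \<phi>) w = v"
      using inv_into_f_f[OF smooth_atlasD(4)[OF at c(1)] c(2)] x(3)
      by (simp add: G_def h_def \<pi>w) (simp add: w_def)
    ultimately show "v \<in> (\<Union>c\<in>\<A>. G c ` Z c)" using c(1) by force
  qed
  moreover have "negligible (\<Union>c\<in>\<A>. G c ` Z c)"
    using cnt neg by (intro negligible_countable_Union) auto
  ultimately show "negligible (\<pi> -` \<psi> ` (g ` N \<inter> V))" by (rule negligible_subset[rotated])
qed

lemma smooth_atlas_countable_subatlas: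
  fixes \<A> :: "('a::second_countable_topology, 'e::euclidean_space) chart set"
  assumes "smooth_atlas E \<A>"
  obtains \<C> where "\<C> \<subseteq> \<A>" "countable \<C>" "smooth_atlas E \<C>"
proof -
  have "\<And>U. U \<in> fst ` \<A> \<Longrightarrow> open U" using smooth_atlasD(1)[OF assms] by auto
  then obtain \<F> where F: "\<F> \<subseteq> fst ` \<A>" "countable \<F>" "\<Union>\<F> = \<Union>(fst ` \<A>)"
    using Lindelof[of "fst ` \<A>"] by metis
  then obtain \<C> where C: "\<C> \<subseteq> \<A>" "countable \<C>" "\<F> = fst ` \<C>"
    using countable_subset_image[THEN iffD1, OF conjI, OF F(2,1)] by auto
  have "(\<Union>(U, \<phi>)\<in>\<C>. U) = UNIV"
  proof (intro set_eqI iffI UNIV_I)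
    fix x
    obtain U \<phi> where "(U, \<phi>) \<in> \<A>" "x \<in> U" by (rule smooth_atlas_cover[OF assms])
    then have "x \<in> \<Union>\<F>" unfolding F(3) by force
    then show "x \<in> (\<Union>(U, \<phi>)\<in>\<C>. U)" unfolding C(3) by force
  qed
  then have "smooth_atlas E \<C>"
    using assms unfolding smooth_atlas_def by (simp add: Ball_def case_prod_beta) (use C(1) in blast)
  with C show ?thesis by (intro that)
qed

lemma Ck_on_1_imp_differentiable_on: "Ck_on 1 E S f \<Longrightarrow> f differentiable_on S"
  by (auto simp: One_nat_def differentiable_on_def differentiable_def)

lemma Ck_mapD:
  assumes "Ck_map k E \<A> \<B> g" "(U, \<phi>) \<in> \<A>" "(V, \<psi>) \<in> \<B>"
  shows "Ck_on k E (\<phi> ` (U \<inter> g -` V)) (\<psi> \<circ> g \<circ> inv_into U \<phi>)"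
proof -
  have "\<forall>(U, \<phi>)\<in>\<A>. \<forall>(V, \<psi>)\<in>\<B>.
      Ck_on k E (\<phi> ` (U \<inter> g -` V)) (\<psi> \<circ> g \<circ> inv_into U \<phi>)"
    using assms(1) unfolding Ck_map_def by (elim conjE)
  from bspec[OF bspec[OF this assms(2), unfolded prod.case] assms(3)] show ?thesis
    by (simp only: prod.case)
qed

lemma Ck_map_1_imp_chart_differentiable:
  assumes "Ck_map 1 E \<A> \<A> g" "\<C> \<subseteq> \<A>"
  shows "chart_differentiable \<C> g"
  unfolding chart_differentiable_def
proof clarify
  fix U \<phi> V \<psi> assume "(U, \<phi>) \<in> \<C>" "(V, \<psi>) \<in> \<C>"
  then have "(U, \<phi>) \<in> \<A>" "(V, \<psi>) \<in> \<A>" using assms(2) by auto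
  then have "Ck_on 1 E (\<phi> ` (U \<inter> g -` V)) (\<psi> \<circ> g \<circ> inv_into U \<phi>)"
    by (rule Ck_mapD[OF assms(1)])
  then show "(\<psi> \<circ> g \<circ> inv_into U \<phi>) differentiable_on \<phi> ` (U \<inter> g -` V)"
    by (rule Ck_on_1_imp_differentiable_on)
qed

text \<open>
  A right translation is the group operation restricted to the slice on which the second argument is
  fixed, so its chart expressions are those of the group operation composed with
  \<open>a \<mapsto> (a, \<phi>'(y))\<close>.
\<close>

lemma lie_group_right_translation_differentiable:
  assumes lie: "lie_group E \<A>" and "\<C> \<subseteq> \<A>"
  shows "chart_differentiable \<C> (\<lambda>x. x + y)"
  unfolding chart_differentiable_def
proof (clarify)
  fix U \<phi> V \<psi> assume "(U, \<phi>) \<in> \<C>" "(V, \<psi>) \<in> \<C>"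
  then have c: "(U, \<phi>) \<in> \<A>" "(V, \<psi>) \<in> \<A>" using assms by auto
  have at: "smooth_atlas E \<A>" using lie by (simp add: lie_group_def)
  obtain U' \<phi>' where c': "(U', \<phi>') \<in> \<A>" "y \<in> U'" by (rule smooth_atlas_cover[OF at])
  define H where "H = \<psi> \<circ> (\<lambda>(x, y). x + y) \<circ> inv_into (U \<times> U') (map_prod \<phi> \<phi>')"
  define W where "W = map_prod \<phi> \<phi>' ` ((U \<times> U') \<inter> (\<lambda>(x, y). x + y) -` V)"
  have "(U \<times> U', map_prod \<phi> \<phi>') \<in> prod_atlas \<A> \<A>" using c c' by (auto simp: prod_atlas_def)
  moreover have "Ck_map 1 (E \<times> E) (prod_atlas \<A> \<A>) \<A> (\<lambda>(x, y). x + y)"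
    using lie unfolding lie_group_def by blast
  ultimately have "Ck_on 1 (E \<times> E) W H"
    unfolding H_def W_def using c(2) by (intro Ck_mapD)
  then have H: "H differentiable_on W" by (rule Ck_on_1_imp_differentiable_on)
  have inj: "inj_on (map_prod \<phi> \<phi>') (U \<times> U')"
    using smooth_atlasD(4)[OF at c(1)] smooth_atlasD(4)[OF at c'(1)] by (auto simp: inj_on_def)
  have inv: "inv_into (U \<times> U') (map_prod \<phi> \<phi>') (\<phi> x, \<phi>' y) = (x, y)" if "x \<in> U" for x
    using inv_into_f_f[OF inj, of "(x, y)"] that c'(2) by simp
  have "(\<lambda>a. H (a, \<phi>' y)) differentiable_on \<phi> ` (U \<inter> (\<lambda>x. x + y) -` V)"
  proof (rule differentiable_on_compose[of "\<lambda>a. (a, \<phi>' y)"])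
    show "(\<lambda>a. (a, \<phi>' y)) differentiable_on \<phi> ` (U \<inter> (\<lambda>x. x + y) -` V)"
      unfolding differentiable_on_def differentiable_def
      by (auto intro!: exI derivative_intros)
    show "H differentiable_on (\<lambda>a. (a, \<phi>' y)) ` \<phi> ` (U \<inter> (\<lambda>x. x + y) -` V)"
      using c'(2) by (intro differentiable_on_subset[OF H]) (force simp: W_def)
  qed
  moreover have "H (a, \<phi>' y) = (\<psi> \<circ> (\<lambda>x. x + y) \<circ> inv_into U \<phi>) a"
    if "a \<in> \<phi> ` (U \<inter> (\<lambda>x. x + y) -` V)" for a
    using that inv inv_into_f_f[OF smooth_atlasD(4)[OF at c(1)]] by (auto simp: H_def)
  ultimately show "(\<psi> \<circ> (\<lambda>x. x + y) \<circ> inv_into U \<phi>) differentiable_on \<phi> ` (U \<inter> (\<lambda>x. x + y) -` V)"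
    unfolding differentiable_on_def
    by (metis (no_types, lifting) differentiable_transform_within zero_less_one)
qed

text \<open>
  Let \<open>W\<close> be the cylinder over the chart domain and \<open>j : W \<rightarrow> U\<close> the inverse chart.  Both sides say
  that \<open>{(w, y). j(w) + y \<in> N}\<close> is null for Lebesgue measure times \<open>p\<close>: by left invariance all
  its sections at \<open>w \<in> W\<close> have measure \<open>p(N)\<close> and \<open>W\<close>, open and nonempty, is not negligible; and
  its section at \<open>y\<close> is the cylinder over the
  chart image of \<open>{x. x + y \<in> N}\<close>.
\<close>

lemma haar_null_iff_translates_chart_null:
  fixes p :: "'a::{topological_group_add, second_countable_topology} measure"
  assumes haar: "normalized_haar p" and at: "smooth_atlas E \<A>"
    and \<pi>: "linear \<pi>" "\<forall>v\<in>E. \<pi> v = v" "range \<pi> \<subseteq> E"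
    and c: "(U, \<phi>) \<in> \<A>" "U \<noteq> {}" and N[measurable]: "N \<in> sets borel"
  shows "emeasure p N = 0 \<longleftrightarrow>
    (AE y in p. negligible (\<pi> -` \<phi> ` ((\<lambda>x. x + y) -` N \<inter> U)))"
proof -
  note s[measurable_cong] = sets_haar[OF haar] and sp = space_haar[OF haar] and pr = haar_prob_space[OF haar]
  interpret prob_space p by fact
  interpret pair_sigma_finite lborel p ..
  define W where "W = \<pi> -` \<phi> ` U"
  obtain T where T: "open T" "\<phi> ` U = E \<inter> T"
    using smooth_atlasD(2)[OF at c(1)] by (auto simp: openin_open)
  have "W = \<pi> -` T" using T(2) rangeI[THEN subsetD[OF \<pi>(3)]] by (auto simp: W_def)
  then have W: "open W"
    using T(1) linear_continuous_on[OF linear_conv_bounded_linear[THEN iffD1, OF \<pi>(1)]]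
    by (auto intro: open_vimage)
  have "W \<noteq> {}" using c(2) \<pi>(2) smooth_atlasD(5)[OF at c(1)] by (fastforce simp: W_def)
  \<comment> \<open>the value outside \<open>W\<close> is arbitrary; it makes \<open>j\<close> Borel on the whole space\<close>
  define j where "j w = (if w \<in> W then inv_into U \<phi> (\<pi> w) else 0)" for w
  have [measurable]: "W \<in> sets borel" using W by simp
  have cj: "continuous_on W (\<lambda>w. inv_into U \<phi> (\<pi> w))"
    using smooth_atlasD(3)[OF at c(1)] linear_continuous_on[OF linear_conv_bounded_linear[THEN iffD1, OF \<pi>(1)], of W]
    by (intro continuous_on_compose2[of "\<phi> ` U" "inv_into U \<phi>" W \<pi>]) (auto simp: W_def)
  have [measurable]: "j \<in> borel_measurable borel"
    unfolding j_def[abs_def] by (intro borel_measurable_continuous_on_if cj) auto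
  have eq: "\<pi> -` \<phi> ` ((\<lambda>x. x + y) -` N \<inter> U) = {w \<in> W. j w + y \<in> N}" for y
    using inv_into_f_f[OF smooth_atlasD(4)[OF at c(1)]] by (auto simp: W_def j_def)
  have neg: "negligible {w \<in> W. j w + y \<in> N} \<longleftrightarrow> (AE w in lborel. \<not> (w \<in> W \<and> j w + y \<in> N))" for y
    unfolding negligible_iff_null_sets
    by (subst null_sets_completion_iff) (auto simp: AE_iff_null_sets eventually_ae_filter)
  have trans: "(AE y in p. \<not> (w \<in> W \<and> j w + y \<in> N)) \<longleftrightarrow> (w \<in> W \<longrightarrow> emeasure p N = 0)" for w
  proof -
    have "(AE y in p. j w + y \<notin> N) \<longleftrightarrow> (AE y in distr p p (\<lambda>y. j w + y). y \<notin> N)"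
      by (subst AE_distr_iff) auto
    also have "\<dots> \<longleftrightarrow> emeasure p N = 0"
      unfolding haar_left_distr[OF haar] using s AE_iff_null_sets[of N p] by (auto simp: null_sets_def)
    finally show ?thesis by (cases "w \<in> W") auto
  qed
  have "(AE y in p. negligible (\<pi> -` \<phi> ` ((\<lambda>x. x + y) -` N \<inter> U))) \<longleftrightarrow>
      (AE w in lborel. w \<in> W \<longrightarrow> emeasure p N = 0)"
    unfolding eq neg trans[symmetric] by (rule AE_commute[symmetric]) measurable
  also have "\<dots> \<longleftrightarrow> emeasure p N = 0"
  proof
    assume ae: "AE w in lborel. w \<in> W \<longrightarrow> emeasure p N = 0"
    show "emeasure p N = 0"
    proof (rule ccontr)
      assume "emeasure p N \<noteq> 0"
      then have "AE w in lborel. w \<notin> W" using ae by auto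
      then have "negligible W"
        using AE_iff_null_sets[of W lborel] by (simp add: negligible_iff_null_sets null_sets_completion_iff)
      then show False using open_not_negligible[OF W \<open>W \<noteq> {}\<close>] by simp
    qed
  qed auto
  finally show ?thesis ..
qed

text \<open>
  Since \<open>g -` N\<close> is the image of \<open>N\<close> under the differentiable map \<open>inv g\<close>, it is enough to pass
  between Haar-null and chart-null sets.  The Fubini argument does so only up to a translation by
  some \<open>y\<close>, which is undone by a right translation, again a differentiable map.
\<close>

theorem lie_group_C1_diffeomorphism_vimage_null:
  fixes p :: "'a::{topological_group_add, t2_space, second_countable_topology} measure"
  assumes lie: "lie_group E \<A>" and haar: "normalized_haar p"
    and diffeo: "C1_diffeomorphism E \<A> g" and N: "N \<in> null_sets p"
  shows "g -` N \<in> null_sets p"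
proof -
  note s = sets_haar[OF haar] and sp = space_haar[OF haar] and pr = haar_prob_space[OF haar]
  interpret prob_space p by fact
  have "smooth_atlas E \<A>" using lie by (simp add: lie_group_def)
  then obtain \<C> where C: "\<C> \<subseteq> \<A>" "countable \<C>" "smooth_atlas E \<C>"
    by (rule smooth_atlas_countable_subatlas)
  have "subspace E" using C(3) unfolding smooth_atlas_def by (elim conjE)
  then obtain \<pi> :: "'b \<Rightarrow> 'b" where \<pi>: "range \<pi> \<subseteq> E" "linear \<pi>" "\<forall>v\<in>E. \<pi> v = v"
    using linear_exists_left_inverse_on[of "id :: 'b \<Rightarrow> 'b" E] by (auto simp: linear_id)
  note image = chart_null_image[OF C(3,2) \<pi>(2,3,1)]
  note Fubini = haar_null_iff_translates_chart_null[OF haar C(3) \<pi>(2,3,1)]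
  have to_charts: "chart_null \<pi> \<C> A" if A: "A \<in> sets borel" "emeasure p A = 0" for A
  proof -
    have "AE y in p. \<forall>c\<in>\<C>. negligible (\<pi> -` snd c ` ((\<lambda>x. x + y) -` A \<inter> fst c))"
    proof (subst AE_ball_countable[OF C(2)], rule ballI)
      fix c assume "c \<in> \<C>"
      then show "AE y in p. negligible (\<pi> -` snd c ` ((\<lambda>x. x + y) -` A \<inter> fst c))"
        using Fubini[of "fst c" "snd c", OF _ _ A(1)] A(2) by (cases "fst c = {}") auto
    qed
    then obtain y where "\<forall>c\<in>\<C>. negligible (\<pi> -` snd c ` ((\<lambda>x. x + y) -` A \<inter> fst c))"
      using eventually_happens'[OF ae_filter_bot] by blast
    then have "chart_null \<pi> \<C> ((\<lambda>x. x + y) -` A)" by (auto simp: chart_null_def)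
    then have "chart_null \<pi> \<C> ((\<lambda>x. x + y) ` (\<lambda>x. x + y) -` A)"
      by (rule image[OF lie_group_right_translation_differentiable[OF lie C(1)]])
    moreover have "(\<lambda>x. x + y) ` (\<lambda>x. x + y) -` A = A"
      by (intro surj_image_vimage_eq surjI[of _ "\<lambda>x. x - y"]) simp
    ultimately show ?thesis by simp
  qed
  have from_charts: "emeasure p A = 0" if A: "A \<in> sets borel" "chart_null \<pi> \<C> A" for A
  proof -
    obtain U \<phi> where c: "(U, \<phi>) \<in> \<C>" "U \<noteq> {}" using smooth_atlas_cover[OF C(3)] by blast
    have "negligible (\<pi> -` \<phi> ` ((\<lambda>x. x + y) -` A \<inter> U))" for y
    proof -
      have "(\<lambda>x. x + y) -` A = (\<lambda>x. x + (- y)) ` A"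
        by (auto simp: image_iff) (metis add_diff_cancel)
      then have "chart_null \<pi> \<C> ((\<lambda>x. x + y) -` A)"
        using image[OF lie_group_right_translation_differentiable[OF lie C(1)] A(2), of "- y"] by simp
      then show ?thesis using c by (auto simp: chart_null_def)
    qed
    then show ?thesis using Fubini[OF c A(1)] by simp
  qed
  have b: "bij g" and Ck: "Ck_map 1 E \<A> \<A> g" "Ck_map 1 E \<A> \<A> (inv g)"
    using diffeo by (auto simp: C1_diffeomorphism_def)
  have "continuous_on UNIV g" using Ck(1) by (simp add: Ck_map_def)
  then have "g \<in> borel_measurable borel" by (rule borel_measurable_continuous_onI)
  then have B: "g -` N \<in> sets borel" using N s measurable_sets[of g borel borel N] by auto
  have "chart_null \<pi> \<C> N" using N s by (intro to_charts) auto
  then have "chart_null \<pi> \<C> (inv g ` N)"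
    by (rule image[OF Ck_map_1_imp_chart_differentiable[OF Ck(2) C(1)]])
  then have "emeasure p (g -` N) = 0"
    using B b by (intro from_charts) (simp_all add: bij_vimage_eq_inv_image)
  then show ?thesis using B s by auto
qed

section \<open>Birkhoff's theorem for bounded functions\<close>

text \<open>
  This is the maximal ergodic argument.  The set \<open>G\<close> where the Birkhoff sums \<open>S\<^sub>n\<close> are unbounded above
  is invariant, so it has measure 0 or 1.  For the running maxima
  \<open>X\<^sub>n = max(0, S\<^sub>1, \<dots>, S\<^sub>n)\<close> one has \<open>X\<^sub>n\<^sub>+\<^sub>1 - X\<^sub>n \<circ> T = max(- X\<^sub>n \<circ> T, \<psi>)\<close>.  By
  invariance the left-hand side has the integral of \<open>X\<^sub>n\<^sub>+\<^sub>1 - X\<^sub>n \<ge> 0\<close>.  On \<open>G\<close> the right-hand side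
  tends to \<open>\<psi>\<close>, so if \<open>G\<close> had measure 1 the mean of \<open>\<psi>\<close> would be nonnegative.
\<close>

lemma ergodic_negative_mean_imp_bounded_above:
  fixes \<psi> :: "'z \<Rightarrow> real"
  assumes erg: "ergodic_prob T M" and [measurable]: "\<psi> \<in> borel_measurable M"
    and bound: "\<And>z. z \<in> space M \<Longrightarrow> \<bar>\<psi> z\<bar> \<le> C" and neg: "(\<integral>z. \<psi> z \<partial>M) < 0"
  shows "AE z in M. \<exists>B. \<forall>n. (\<Sum>j<n. \<psi> ((T ^^ j) z)) \<le> B"
proof -
  have "prob_space M" and T[measurable]: "T \<in> measurable M M" and inv: "distr M M T = M"
    using erg by (auto simp: ergodic_prob_def invariant_prob_def)
  interpret prob_space M by fact
  have Tsp: "T z \<in> space M" if "z \<in> space M" for z using measurable_space[OF T that] .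
  define S where "S n z = (\<Sum>j<n. \<psi> ((T ^^ j) z))" for n z
  have S_Suc: "S (Suc n) z = \<psi> z + S n (T z)" for n z
    unfolding S_def by (subst sum.lessThan_Suc_shift) (simp add: funpow_swap1)
  have [measurable]: "(T ^^ j) \<in> measurable M M" for j
    by (induction j) (simp_all add: measurable_ident_sets)
  have [measurable]: "S n \<in> borel_measurable M" for n unfolding S_def by measurable
  define G where "G = {z \<in> space M. \<not> (\<exists>B::nat. \<forall>n. S n z \<le> real B)}"
  have G_sets: "G \<in> sets M" unfolding G_def by measurable
  have G_iff: "z \<in> G \<longleftrightarrow> z \<in> space M \<and> \<not> (\<exists>B. \<forall>n. S n z \<le> B)" for z
    unfolding G_def using order_trans[OF _ of_nat_ceiling] by blast
  have "T -` G \<inter> space M = G"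
  proof (intro set_eqI iffI)
    fix z assume z: "z \<in> T -` G \<inter> space M"
    have "\<not> (\<forall>n. S n z \<le> B)" for B
    proof
      assume "\<forall>n. S n z \<le> B"
      then have "\<forall>n. S n (T z) \<le> B - \<psi> z" using S_Suc[of _ z] by (metis add.commute le_diff_eq)
      then show False using z G_iff by auto
    qed
    then show "z \<in> G" using z G_iff by auto
  next
    fix z assume z: "z \<in> G"
    have "\<not> (\<forall>n. S n (T z) \<le> B)" for B
    proof
      assume B: "\<forall>n. S n (T z) \<le> B"
      have "S n z \<le> max 0 (\<psi> z + B)" for n
        using B by (cases n) (auto simp: S_Suc S_def[of 0] le_max_iff_disj)
      then show False using z G_iff by blast
    qed
    then show "z \<in> T -` G \<inter> space M" using z Tsp G_iff by auto
  qed
  then have G01: "prob G = 0 \<or> prob G = 1"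
    using erg G_sets by (auto simp: ergodic_prob_def)
  have "prob G \<noteq> 1"
  proof
    assume "prob G = 1"
    then have aeG: "AE z in M. z \<in> G" using AE_in_set_eq_1[OF G_sets] by simp
    \<comment> \<open>recursive form of \<open>max(0, S\<^sub>1, \<dots>, S\<^sub>n)\<close>, in which the first step is split off\<close>
    define X where "X = rec_nat (\<lambda>z. 0) (\<lambda>n g z. max 0 (\<psi> z + g (T z)))"
    have X0: "X 0 z = 0" and X_Suc: "X (Suc n) z = max 0 (\<psi> z + X n (T z))" for n z
      by (simp_all add: X_def)
    have X_nonneg: "0 \<le> X n z" for n z by (cases n) (auto simp: X0 X_Suc)
    have X_mono: "X n z \<le> X (Suc n) z" for n z
    proof (induction n arbitrary: z)
      case (Suc n) then show ?case
        unfolding X_Suc[of "Suc n"] X_Suc[of n] by (intro max.mono add_left_mono order_refl)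
    qed (auto simp: X0 X_nonneg)
    have S_le_X: "S n z \<le> X n z" for n z
      by (induction n arbitrary: z) (auto simp: X0 X_Suc S_Suc S_def[of 0] le_max_iff_disj)
    have X_meas[measurable]: "X n \<in> borel_measurable M" for n
      by (induction n) (simp_all add: X0[abs_def] X_Suc[abs_def])
    have X_bound: "X n z \<le> real n * \<bar>C\<bar>" if "z \<in> space M" for n z
      using that
    proof (induction n arbitrary: z)
      case (Suc n)
      then show ?case using bound[of z] Suc.IH[OF Tsp, of z]
        by (auto simp: X_Suc algebra_simps intro: order_trans[OF add_mono])
    qed (simp add: X0)
    have X_int: "integrable M (X n)" for n
      by (rule integrable_const_bound[where B="real n * \<bar>C\<bar>"]) (auto simp: X_nonneg X_bound)
    have X_int_T: "integrable M (\<lambda>z. X n (T z))"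
        "(\<integral>z. X n (T z) \<partial>M) = (\<integral>z. X n z \<partial>M)" for n
      using integrable_distr_eq[OF T X_meas] integral_distr[OF T X_meas] X_int[of n]
      by (simp_all add: inv)
    have D: "X (Suc n) z - X n (T z) = max (- X n (T z)) (\<psi> z)" for n z by (simp add: X_Suc)
    have "(\<lambda>n. \<integral>z. max (- X n (T z)) (\<psi> z) \<partial>M) \<longlonglongrightarrow> (\<integral>z. \<psi> z \<partial>M)"
    proof (rule integral_dominated_convergence[where w="\<lambda>_. \<bar>C\<bar>"])
      show "AE z in M. (\<lambda>n. max (- X n (T z)) (\<psi> z)) \<longlonglongrightarrow> \<psi> z"
        using aeG
      proof eventually_elim
        case (elim z)
        then have "T z \<in> G" using \<open>T -` G \<inter> space M = G\<close> by auto
        then obtain k where k: "S k (T z) > - \<psi> z" using G_iff not_less by blast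
        have "max (- X n (T z)) (\<psi> z) = \<psi> z" if "k \<le> n" for n
        proof -
          have "X k (T z) \<le> X n (T z)" using X_mono that by (rule lift_Suc_mono_le)
          then show ?thesis using k S_le_X[of k "T z"] by (simp add: max_def)
        qed
        then show ?case by (auto intro!: tendsto_eventually eventually_sequentiallyI)
      qed
      show "AE z in M. norm (max (- X n (T z)) (\<psi> z)) \<le> \<bar>C\<bar>" for n
      proof (rule AE_I2)
        fix z assume "z \<in> space M"
        then show "norm (max (- X n (T z)) (\<psi> z)) \<le> \<bar>C\<bar>"
          using bound[of z] X_nonneg[of n "T z"] by (auto simp: max_def abs_if split: if_splits)
      qed
    qed auto
    moreover have "0 \<le> (\<integral>z. max (- X n (T z)) (\<psi> z) \<partial>M)" for n
    proof -
      have "(\<integral>z. max (- X n (T z)) (\<psi> z) \<partial>M) = (\<integral>z. X (Suc n) z \<partial>M) - (\<integral>z. X n z \<partial>M)"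
        unfolding D[symmetric] using X_int X_int_T by simp
      also have "\<dots> \<ge> 0" using integral_mono[OF X_int X_int X_mono] by simp
      finally show ?thesis .
    qed
    ultimately have "0 \<le> (\<integral>z. \<psi> z \<partial>M)" by (intro LIMSEQ_le_const) auto
    with neg show False by simp
  qed
  then have "AE z in M. z \<notin> G" using G01 G_sets by (simp add: prob_eq_0)
  then show ?thesis using AE_space
    by eventually_elim (auto simp: G_iff S_def)
qed

text \<open>
  For every \<open>e > 0\<close> both \<open>\<phi> - I - e\<close> and \<open>I - e - \<phi>\<close>, where \<open>I\<close> is the mean of \<open>\<phi>\<close>, have negative
  mean, so their Birkhoff sums are bounded above almost everywhere; dividing by \<open>n\<close> puts all limit
  points of the averages within \<open>e\<close> of \<open>I\<close>.
\<close>

theorem ergodic_bounded_birkhoff: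
  fixes \<phi> :: "'z \<Rightarrow> real"
  assumes erg: "ergodic_prob T M" and [measurable]: "\<phi> \<in> borel_measurable M"
    and bound: "\<And>z. z \<in> space M \<Longrightarrow> \<bar>\<phi> z\<bar> \<le> C"
  shows "AE z in M. (\<lambda>n. (\<Sum>j<n. \<phi> ((T ^^ j) z)) / real n) \<longlonglongrightarrow> (\<integral>z. \<phi> z \<partial>M)"
proof -
  have "prob_space M" using erg by (auto simp: ergodic_prob_def invariant_prob_def)
  interpret prob_space M by fact
  define I where "I = (\<integral>z. \<phi> z \<partial>M)"
  have int: "integrable M \<phi>"
    using bound by (intro integrable_const_bound[where B=C]) auto
  have upper: "AE z in M. \<exists>B. \<forall>n. (\<Sum>j<n. \<phi> ((T ^^ j) z) - I - e) \<le> B" if "0 < e" for e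
    using bound int that
    by (intro ergodic_negative_mean_imp_bounded_above[OF erg, where C="C + \<bar>I\<bar> + e"])
       (fastforce simp: prob_space I_def)+
  have lower: "AE z in M. \<exists>B. \<forall>n. (\<Sum>j<n. I - e - \<phi> ((T ^^ j) z)) \<le> B" if "0 < e" for e
    using bound int that
    by (intro ergodic_negative_mean_imp_bounded_above[OF erg, where C="C + \<bar>I\<bar> + e"])
       (fastforce simp: prob_space I_def)+
  have "AE z in M. \<forall>k. (\<exists>B. \<forall>n. (\<Sum>j<n. \<phi> ((T ^^ j) z) - I - 1 / real (Suc k)) \<le> B) \<and>
      (\<exists>B. \<forall>n. (\<Sum>j<n. I - 1 / real (Suc k) - \<phi> ((T ^^ j) z)) \<le> B)"
    using upper lower by (simp add: AE_all_countable)
  then show ?thesis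
  proof eventually_elim
    case (elim z)
    define A where "A n = (\<Sum>j<n. \<phi> ((T ^^ j) z))" for n
    have "(\<lambda>n. A n / real n) \<longlonglongrightarrow> I"
    proof (rule LIMSEQ_I)
      fix r :: real assume r: "0 < r"
      then obtain k where "inverse (real (Suc k)) < r / 2" using reals_Archimedean[of "r / 2"] by auto
      then have k: "1 / real (Suc k) < r / 2" by (simp add: inverse_eq_divide)
      define e where "e = 1 / real (Suc k)"
      from elim obtain B1 B2 where "\<And>n. (\<Sum>j<n. \<phi> ((T ^^ j) z) - I - e) \<le> B1"
          "\<And>n. (\<Sum>j<n. I - e - \<phi> ((T ^^ j) z)) \<le> B2"
        unfolding e_def by metis
      then have B: "A n - real n * I - real n * e \<le> B1" "real n * I - real n * e - A n \<le> B2" for n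
        by (simp_all add: sum_subtractf A_def right_diff_distrib)
      obtain N where N: "2 * max B1 B2 / r < real N" using reals_Archimedean2 by blast
      have "norm (A n / real n - I) < r" if n: "n \<ge> Suc N" for n
      proof -
        have n0: "0 < real n" using n by simp
        have "2 * max B1 B2 / r < real n" using N n by linarith
        then have "max B1 B2 < real n * (r / 2)" using r by (simp add: field_simps)
        moreover have "real n * e < real n * (r / 2)" unfolding e_def by (rule mult_strict_left_mono[OF k n0])
        ultimately have "\<bar>A n - real n * I\<bar> < real n * r"
          using B[of n] by (auto simp: abs_less_iff)
        moreover have "A n / real n - I = (A n - real n * I) / real n" using n0 by (simp add: field_simps)
        ultimately show ?thesis using n0 by (simp add: abs_divide divide_less_eq mult.commute)
      qed
      then show "\<exists>no. \<forall>n\<ge>no. norm (A n / real n - I) < r" by blast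
    qed
    then show ?case by (simp add: A_def I_def)
  qed
qed

section \<open>The one-sided Bernoulli shift\<close>

lemma measurable_shift: "shift \<in> measurable (Pi\<^sub>M UNIV (\<lambda>_. M)) (Pi\<^sub>M UNIV (\<lambda>_. M))"
  unfolding shift_def[abs_def] by (rule measurable_PiM_single') (auto simp: space_PiM)

lemma shift_comb_seq: "(shift ^^ n) (comb_seq n \<omega> \<omega>') = \<omega>'"
proof -
  have "(shift ^^ n) \<omega> i = \<omega> (n + i)" for \<omega> :: "nat \<Rightarrow> 'a" and i
    by (induction n arbitrary: i) (auto simp: shift_def)
  then show ?thesis by (auto simp: comb_seq_def)
qed

lemma shift_case_nat: "shift (case_nat a \<omega>) = \<omega>"
  by (simp add: shift_def)

context sequence_space
begin

lemma distr_shift: "distr S S shift = S"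
proof -
  note measurable_shift[measurable]
  have "distr S S shift = distr (distr (M \<Otimes>\<^sub>M S) S (\<lambda>(s, \<omega>). case_nat s \<omega>)) S shift"
    by (simp only: PiM_iter)
  also have "\<dots> = distr (M \<Otimes>\<^sub>M S) S snd"
    by (subst distr_distr) (auto simp: comp_def shift_case_nat split_beta')
  also have "\<dots> = S" 
  proof (rule measure_eqI)
    fix A assume "A \<in> sets (distr (M \<Otimes>\<^sub>M S) S snd)"
    then have A[measurable]: "A \<in> sets S" by simp
    have "snd -` A \<inter> space (M \<Otimes>\<^sub>M S) = space M \<times> A"
      using sets.sets_into_space[OF A] by (auto simp: space_pair_measure)
    then show "emeasure (distr (M \<Otimes>\<^sub>M S) S snd) A = emeasure S A"
      by (simp add: emeasure_distr P.emeasure_pair_measure_Times M.emeasure_space_1)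
  qed simp
  finally show ?thesis .
qed

text \<open>
  An invariant set \<open>A\<close> equals its preimage under the \<open>n\<close>-th power of the shift, so it is determined by the
  coordinates from \<open>n\<close> on and is independent of all cylinders over the first \<open>n\<close> coordinates.
  Cylinders generate, so the restriction of the measure to \<open>A\<close> is the measure scaled by that of
  \<open>A\<close>; evaluated at \<open>A\<close> this says that the measure of \<open>A\<close> is its own square.
\<close>

lemma shift_invariant_measure_0_1:
  assumes A[measurable]: "A \<in> sets S" and inv: "shift -` A \<inter> space S = A"
  shows "measure S A = 0 \<or> measure S A = 1"
proof -
  have iter: "(shift ^^ n) \<omega> \<in> A \<longleftrightarrow> \<omega> \<in> A" if "\<omega> \<in> space S" for n \<omega>
    using that
  proof (induction n arbitrary: \<omega>)
    case (Suc n)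
    then show ?case using inv measurable_space[OF measurable_shift Suc.prems]
      by (subst funpow_Suc_right) auto
  qed simp
  have "density S (indicator A) = scale_measure (emeasure S A) S"
  proof (rule measure_eqI_PiM_infinite)
    show "finite_measure (density S (indicator A))"
      by (rule finite_measureI) (simp add: emeasure_density P.emeasure_eq_measure)
  next
    fix F J assume J: "finite J" "J \<subseteq> (UNIV :: nat set)" "\<And>i. i \<in> J \<Longrightarrow> F i \<in> sets M"
    define Z where "Z = prod_emb UNIV (\<lambda>_::nat. M) J (Pi\<^sub>E J F)"
    have Z[measurable]: "Z \<in> sets S" unfolding Z_def using J by (intro sets_PiM_I) auto
    obtain n where n: "J \<subseteq> {..<n}" using J(1) finite_nat_iff_bounded by auto
    have comb: "comb_seq n \<omega> \<omega>' \<in> space S" if "\<omega> \<in> space S" "\<omega>' \<in> space S" for \<omega> \<omega>'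
      using that by (auto simp: space_PiM PiE_iff comb_seq_def)
    have "(\<lambda>(\<omega>, \<omega>'). comb_seq n \<omega> \<omega>') -` (Z \<inter> A) \<inter> space (S \<Otimes>\<^sub>M S) = Z \<times> A"
    proof -
      have "comb_seq n \<omega> \<omega>' \<in> Z \<longleftrightarrow> \<omega> \<in> Z" if "\<omega> \<in> space S" "\<omega>' \<in> space S" for \<omega> \<omega>'
        using that n by (auto simp: Z_def prod_emb_def comb_seq_def space_PiM PiE_iff subset_iff)
      moreover have "comb_seq n \<omega> \<omega>' \<in> A \<longleftrightarrow> \<omega>' \<in> A" if "\<omega> \<in> space S" "\<omega>' \<in> space S" for \<omega> \<omega>'
        using iter[OF comb[OF that], of n] by (simp add: shift_comb_seq)
      ultimately show ?thesis
        using sets.sets_into_space[OF Z, THEN subsetD] sets.sets_into_space[OF A, THEN subsetD]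
        unfolding space_pair_measure by fastforce
    qed
    then have "emeasure (distr (S \<Otimes>\<^sub>M S) S (\<lambda>(\<omega>, \<omega>'). comb_seq n \<omega> \<omega>')) (Z \<inter> A)
        = emeasure S Z * emeasure S A"
      by (simp add: emeasure_distr P.emeasure_pair_measure_Times)
    then have "emeasure S (Z \<inter> A) = emeasure S Z * emeasure S A" by (simp add: PiM_comb_seq)
    then show "emeasure (density S (indicator A)) (prod_emb UNIV (\<lambda>_. M) J (Pi\<^sub>E J F)) =
        emeasure (scale_measure (emeasure S A) S) (prod_emb UNIV (\<lambda>_. M) J (Pi\<^sub>E J F))"
      unfolding Z_def[symmetric]
      by (simp add: emeasure_density mult.commute Int_commute flip: indicator_inter_arith)
  qed simp_all
  then have "emeasure (density S (indicator A)) A = emeasure (scale_measure (emeasure S A) S) A" by simp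
  then have "emeasure S A = emeasure S A * emeasure S A"
    by (simp add: emeasure_density flip: indicator_inter_arith)
  then have "measure S A = measure S A * measure S A"
    by (metis measure_def enn2real_mult)
  then show ?thesis by (metis mult_cancel_right2)
qed

end

section \<open>Linear operators on classes of functions\<close>

abbreviation Linf_class :: "'z measure \<Rightarrow> ('z \<Rightarrow> real) \<Rightarrow> ('z \<Rightarrow> real) set" where
  "Linf_class M \<phi> \<equiv> Linf_rel M `` {\<phi>}"

lemma Linf_class_self: "\<phi> \<in> Linf_fun M \<Longrightarrow> \<phi> \<in> Linf_class M \<phi>"
  by (simp add: Linf_rel_def)

lemma Linf_class_in: "\<phi> \<in> Linf_fun M \<Longrightarrow> Linf_class M \<phi> \<in> Linf M"
  by (auto simp: Linf_def quotient_def)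

lemma Linf_class_eqI: "(\<phi>, \<psi>) \<in> Linf_rel M \<Longrightarrow> Linf_class M \<phi> = Linf_class M \<psi>"
  by (auto simp: Linf_rel_def elim: eventually_elim2)

lemma Linf_cases:
  assumes "c \<in> Linf M"
  obtains \<phi> where "\<phi> \<in> Linf_fun M" "c = Linf_class M \<phi>"
  using assms by (auto simp: Linf_def quotient_def)

lemma Linf_fun_add: "\<phi> \<in> Linf_fun M \<Longrightarrow> \<psi> \<in> Linf_fun M \<Longrightarrow> (\<lambda>z. \<phi> z + \<psi> z) \<in> Linf_fun M"
proof -
  assume "\<phi> \<in> Linf_fun M" "\<psi> \<in> Linf_fun M"
  then obtain C D where "AE z in M. \<bar>\<phi> z\<bar> \<le> C" "AE z in M. \<bar>\<psi> z\<bar> \<le> D"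
      and [measurable]: "\<phi> \<in> borel_measurable M" "\<psi> \<in> borel_measurable M"
    by (auto simp: Linf_fun_def)
  from this(1,2) have "AE z in M. \<bar>\<phi> z + \<psi> z\<bar> \<le> C + D" by eventually_elim auto
  then show ?thesis by (auto simp: Linf_fun_def)
qed

lemma Linf_fun_scale: "\<phi> \<in> Linf_fun M \<Longrightarrow> (\<lambda>z. a * \<phi> z) \<in> Linf_fun M"
proof -
  assume "\<phi> \<in> Linf_fun M"
  then obtain C where "AE z in M. \<bar>\<phi> z\<bar> \<le> C" and [measurable]: "\<phi> \<in> borel_measurable M"
    by (auto simp: Linf_fun_def)
  from this(1) have "AE z in M. \<bar>a * \<phi> z\<bar> \<le> \<bar>a\<bar> * C"
    by eventually_elim (auto simp: abs_mult mult_left_mono)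
  then show ?thesis by (auto simp: Linf_fun_def)
qed

lemma Linf_fun_const: "(\<lambda>_. r) \<in> Linf_fun M"
  by (auto simp: Linf_fun_def)

lemma Linf_add_class:
  assumes "\<phi> \<in> Linf_fun M" "\<psi> \<in> Linf_fun M"
  shows "Linf_add M (Linf_class M \<phi>) (Linf_class M \<psi>) = Linf_class M (\<lambda>z. \<phi> z + \<psi> z)"
proof -
  have "Linf_class M (\<lambda>z. \<phi>' z + \<psi>' z) = Linf_class M (\<lambda>z. \<phi> z + \<psi> z)"
    if "\<phi>' \<in> Linf_class M \<phi>" "\<psi>' \<in> Linf_class M \<psi>" for \<phi>' \<psi>'
    using that by (intro Linf_class_eqI[symmetric])
      (auto simp: Linf_rel_def intro: Linf_fun_add elim: eventually_elim2)
  then show ?thesis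
    unfolding Linf_add_def using Linf_class_self[OF assms(1)] Linf_class_self[OF assms(2)] by blast
qed

lemma Linf_scale_class:
  assumes "\<phi> \<in> Linf_fun M"
  shows "Linf_scale M a (Linf_class M \<phi>) = Linf_class M (\<lambda>z. a * \<phi> z)"
proof -
  have "Linf_class M (\<lambda>z. a * \<phi>' z) = Linf_class M (\<lambda>z. a * \<phi> z)"
    if "\<phi>' \<in> Linf_class M \<phi>" for \<phi>'
    using that by (intro Linf_class_eqI[symmetric])
      (auto simp: Linf_rel_def intro: Linf_fun_scale elim: eventually_mono)
  then show ?thesis
    unfolding Linf_scale_def using Linf_class_self[OF assms] by blast
qed

lemma Linf_lift_class:
  assumes "Linf_respects M T" "\<phi> \<in> Linf_fun M"
  shows "Linf_lift M T (Linf_class M \<phi>) = Linf_class M (T \<phi>)"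
proof -
  have "Linf_class M (T \<psi>) = Linf_class M (T \<phi>)" if "\<psi> \<in> Linf_class M \<phi>" for \<psi>
    using that assms(1) by (intro Linf_class_eqI[symmetric]) (auto simp: Linf_respects_def)
  then show ?thesis
    unfolding Linf_lift_def using Linf_class_self[OF assms(2)] by blast
qed

lemma Linf_respects_fun:
  assumes "Linf_respects M T" "\<phi> \<in> Linf_fun M"
  shows "T \<phi> \<in> Linf_fun M"
proof -
  have "(\<phi>, \<phi>) \<in> Linf_rel M" using assms(2) by (simp add: Linf_rel_def)
  then have "(T \<phi>, T \<phi>) \<in> Linf_rel M" using assms(1) by (simp add: Linf_respects_def)
  then show ?thesis by (simp add: Linf_rel_def)
qed

lemma Linf_linear_lift:
  assumes resp: "Linf_respects M T"
    and add: "\<And>\<phi> \<psi>. \<phi> \<in> Linf_fun M \<Longrightarrow> \<psi> \<in> Linf_fun M \<Longrightarrow>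
      AE z in M. T (\<lambda>z. \<phi> z + \<psi> z) z = T \<phi> z + T \<psi> z"
    and scale: "\<And>a \<phi>. \<phi> \<in> Linf_fun M \<Longrightarrow> AE z in M. T (\<lambda>z. a * \<phi> z) z = a * T \<phi> z"
  shows "Linf_linear M (Linf_lift M T)"
  unfolding Linf_linear_def
proof (intro conjI ballI allI)
  note fn = Linf_respects_fun[OF resp]
  fix c assume "c \<in> Linf M"
  then obtain \<phi> where \<phi>: "\<phi> \<in> Linf_fun M" "c = Linf_class M \<phi>" by (rule Linf_cases)
  show "Linf_lift M T c \<in> Linf M" using \<phi> by (simp add: Linf_lift_class[OF resp] Linf_class_in fn)
  show "Linf_lift M T (Linf_scale M a c) = Linf_scale M a (Linf_lift M T c)" for a
    using \<phi> scale[OF \<phi>(1), of a]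
    by (simp add: Linf_lift_class[OF resp] Linf_scale_class Linf_fun_scale fn)
      (auto intro!: Linf_class_eqI simp: Linf_rel_def Linf_fun_scale fn)
  fix d assume "d \<in> Linf M"
  then obtain \<psi> where \<psi>: "\<psi> \<in> Linf_fun M" "d = Linf_class M \<psi>" by (rule Linf_cases)
  show "Linf_lift M T (Linf_add M c d) = Linf_add M (Linf_lift M T c) (Linf_lift M T d)"
    using \<phi> \<psi> add[OF \<phi>(1) \<psi>(1)]
    by (simp add: Linf_lift_class[OF resp] Linf_add_class Linf_fun_add fn)
      (auto intro!: Linf_class_eqI simp: Linf_rel_def Linf_fun_add fn)
qed

lemma Linf_linear_funpow: "Linf_linear M L \<Longrightarrow> Linf_linear M (L ^^ n)"
  by (induction n) (auto simp: Linf_linear_def)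

text \<open>
  \<open>Linf_dist\<close> is defined through chosen representatives; the essential supremum does not
  depend on the choice.
\<close>

lemma Linf_class_dist:
  assumes M: "prob_space M" and "\<phi> \<in> Linf_fun M" "\<psi> \<in> Linf_fun M"
  shows "Linf_dist M (Linf_class M \<phi>) (Linf_class M \<psi>) =
    real_of_ereal (esssup M (\<lambda>z. ereal \<bar>\<phi> z - \<psi> z\<bar>))"
proof -
  define \<phi>' where "\<phi>' = (SOME f. f \<in> Linf_class M \<phi>)"
  define \<psi>' where "\<psi>' = (SOME f. f \<in> Linf_class M \<psi>)"
  have mem: "\<phi>' \<in> Linf_class M \<phi>" "\<psi>' \<in> Linf_class M \<psi>"
    unfolding \<phi>'_def \<psi>'_def
    by (rule Linf_rep(1)[OF Linf_class_in[OF assms(2)]], rule Linf_rep(1)[OF Linf_class_in[OF assms(3)]])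
  then have ae: "AE z in M. \<phi> z = \<phi>' z" "AE z in M. \<psi> z = \<psi>' z" by (auto simp: Linf_rel_def)
  then have "AE z in M. ereal \<bar>\<phi>' z - \<psi>' z\<bar> = ereal \<bar>\<phi> z - \<psi> z\<bar>" by eventually_elim simp
  moreover have "\<phi> \<in> borel_measurable M" "\<psi> \<in> borel_measurable M"
      "\<phi>' \<in> borel_measurable M" "\<psi>' \<in> borel_measurable M"
    using mem by (auto simp: Linf_rel_def Linf_fun_def)
  ultimately have "esssup M (\<lambda>z. ereal \<bar>\<phi>' z - \<psi>' z\<bar>) = esssup M (\<lambda>z. ereal \<bar>\<phi> z - \<psi> z\<bar>)"
    by (intro esssup_AE_cong) auto
  then show ?thesis by (simp add: Linf_dist_def \<phi>'_def \<psi>'_def)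
qed

text \<open>
  Classes of constant functions form an isometric copy of the real line, and by hypothesis a
  bounded set is mapped into the copy of a compact interval.
\<close>

lemma Linf_compact_op_constants:
  assumes M: "prob_space M" and lin: "Linf_linear M L"
    and const: "\<And>\<phi> C. \<phi> \<in> Linf_fun M \<Longrightarrow> (AE z in M. \<bar>\<phi> z\<bar> \<le> C) \<Longrightarrow>
      \<exists>r. \<bar>r\<bar> \<le> C \<and> L (Linf_class M \<phi>) = Linf_class M (\<lambda>_. r)"
  shows "Linf_compact_op M L"
  unfolding Linf_compact_op_def
proof (intro conjI lin allI impI)
  interpret prob_space M by fact
  have ne: "emeasure M (space M) \<noteq> 0" by (simp add: emeasure_space_1)
  interpret X: Metric_space "Linf M" "Linf_dist M" by (rule Metric_space_Linf[OF M])
  define k where "k r = Linf_class M (\<lambda>_. r :: real)" for r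
  have k_in: "k r \<in> Linf M" for r by (simp add: k_def Linf_class_in Linf_fun_const)
  have k_dist: "Linf_dist M (k r) (k s) = \<bar>r - s\<bar>" for r s
    by (simp add: k_def Linf_class_dist[OF M] Linf_fun_const esssup_const[OF ne])
  have cont: "continuous_map euclidean X.mtopology k"
    unfolding X.continuous_map_to_metric
  proof (intro ballI allI impI)
    fix r e :: real assume "0 < e"
    then show "\<exists>U. openin euclidean U \<and> r \<in> U \<and> (\<forall>y\<in>U. k y \<in> X.mball (k r) e)"
      by (intro exI[of _ "ball r e"]) (auto simp: k_in k_dist dist_real_def)
  qed
  fix B assume "X.mbounded B"
  then obtain c0 R where B: "B \<subseteq> X.mcball c0 R" by (auto simp: X.mbounded_def)
  have "\<exists>K. L ` B \<subseteq> k ` {- K..K}"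
  proof (cases "B = {}")
    case False
    then have c0: "c0 \<in> Linf M" using B by auto
    then obtain \<phi>0 where \<phi>0: "\<phi>0 \<in> Linf_fun M" "c0 = Linf_class M \<phi>0" by (rule Linf_cases)
    then obtain C where C: "AE z in M. \<bar>\<phi>0 z\<bar> \<le> C" by (auto simp: Linf_fun_def)
    have "L c \<in> k ` {- (C + R)..C + R}" if "c \<in> B" for c
    proof -
      have c: "c \<in> Linf M" "Linf_dist M c0 c \<le> R" using that B by auto
      obtain \<phi> where \<phi>: "\<phi> \<in> Linf_fun M" "c = Linf_class M \<phi>" by (rule Linf_cases[OF c(1)])
      obtain r where r: "esssup M (\<lambda>z. ereal \<bar>\<phi>0 z - \<phi> z\<bar>) = ereal r"
          "AE z in M. \<bar>\<phi>0 z - \<phi> z\<bar> \<le> r"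
        using Linf_esssup_diff[OF \<phi>0(1) \<phi>(1) ne] by auto
      then have "r \<le> R" using c(2) Linf_class_dist[OF M \<phi>0(1) \<phi>(1)] by (simp add: \<phi>0(2) \<phi>(2))
      have "AE z in M. \<bar>\<phi> z\<bar> \<le> C + R"
        using C r(2) by eventually_elim (use \<open>r \<le> R\<close> in linarith)
      then obtain s where "\<bar>s\<bar> \<le> C + R" "L c = k s"
        using const[OF \<phi>(1)] by (auto simp: k_def \<phi>(2))
      then show ?thesis by (intro image_eqI[of _ _ s]) auto
    qed
    then show ?thesis by blast
  qed simp
  then obtain K where K: "L ` B \<subseteq> k ` {- K..K}" by blast
  have comp: "compactin X.mtopology (k ` {- K..K})"
    by (rule image_compactin[OF _ cont]) simp
  have "X.mtopology closure_of (L ` B) \<subseteq> k ` {- K..K}"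
    by (intro closure_of_minimal K compactin_imp_closedin X.Hausdorff_space_mtopology comp)
  then show "compactin X.mtopology (X.mtopology closure_of (L ` B))"
    by (rule closed_compactin[OF comp]) simp
qed

section \<open>Random translations\<close>

lemma path_prob_iid:
  assumes "set As \<subseteq> sets p"
  shows "path_prob (\<lambda>_. p) As t = (\<Prod>A\<leftarrow>As. emeasure p A)"
  using assms
proof (induction As arbitrary: t)
  case (Cons A As)
  then show ?case by (simp add: nn_integral_cmult_indicator) (rule mult.commute)
qed simp

text \<open>
  If all transition probabilities equal \<open>p\<close>, the iterated integrals over cylinders are products, and
  these determine the product measure.
\<close>

lemma markov_measure_iid:
  fixes p :: "'t::topological_space measure"
  assumes "prob_space p" and s: "sets p = sets borel" and mm: "markov_measure (\<lambda>_. p) p P"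
  shows "P = (\<Pi>\<^sub>M i\<in>(UNIV :: nat set). p)"
proof -
  interpret p: prob_space p by fact
  interpret sequence_space p by (simp add: sequence_space_def product_prob_spaceI p.prob_space_axioms)
  have sp: "space p = UNIV" using sets_eq_imp_space_eq[OF s] by simp
  have "\<forall>A As. set (A # As) \<subseteq> sets borel \<longrightarrow>
      emeasure P {\<omega>. \<forall>i<length (A # As). \<omega> i \<in> (A # As) ! i} =
        (\<integral>\<^sup>+t\<in>A. path_prob (\<lambda>_. p) As t \<partial>p)"
    using mm unfolding markov_measure_def by (elim conjE)
  note cylinder = this[rule_format]
  show ?thesis
  proof (rule PiM_eq)
    show "sets P = sets S"
      using mm sets_PiM_cong[OF refl, of UNIV "\<lambda>_. borel" "\<lambda>_. p"] s by (simp add: markov_measure_def)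
  next
    fix J F assume J: "finite J" "J \<subseteq> (UNIV :: nat set)" and F: "\<And>j. j \<in> J \<Longrightarrow> F j \<in> sets p"
    obtain n where n: "J \<subseteq> {..<n}" using J(1) finite_nat_iff_bounded by auto
    then have n': "\<And>i. i \<in> J \<Longrightarrow> i < Suc n" by auto
    \<comment> \<open>the Markov measure is given on cylinders over initial segments, so fill up \<open>J\<close> with trivial conditions\<close>
    define G where "G i = (if i \<in> J then F i else UNIV)" for i
    have G: "G i \<in> sets p" for i using F sets.top[of p] by (auto simp: G_def sp)
    have "prod_emb UNIV (\<lambda>_. p) J (Pi\<^sub>E J F) = {\<omega>. \<forall>i<Suc n. \<omega> i \<in> G i}"
      by (auto simp: prod_emb_def sp G_def PiE_iff n')
    also have "\<dots> = {\<omega>. \<forall>i<length (G 0 # map G [1..<Suc n]). \<omega> i \<in> (G 0 # map G [1..<Suc n]) ! i}"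
    proof -
      have "G 0 # map G [1..<Suc n] = map G [0..<Suc n]" by (simp add: upt_conv_Cons del: upt_Suc)
      then show ?thesis by (simp del: upt_Suc)
    qed
    also have "emeasure P \<dots> = (\<integral>\<^sup>+t\<in>G 0. path_prob (\<lambda>_. p) (map G [1..<Suc n]) t \<partial>p)"
      using G s by (intro cylinder) auto
    also have "\<dots> = emeasure p (G 0) * (\<Prod>A\<leftarrow>map G [1..<Suc n]. emeasure p A)"
      using G path_prob_iid[of "map G [1..<Suc n]" p]
      by (simp add: nn_integral_cmult_indicator image_subset_iff del: upt_Suc) (rule mult.commute)
    also have "\<dots> = (\<Prod>A\<leftarrow>map G [0..<Suc n]. emeasure p A)"
      by (simp add: upt_conv_Cons del: upt_Suc)
    also have "\<dots> = (\<Prod>i<Suc n. emeasure p (G i))"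
      by (simp add: prod.list_conv_set_nth atLeast0LessThan del: upt_Suc)
    also have "\<dots> = (\<Prod>i\<in>J. emeasure p (F i))"
      using n by (intro prod.mono_neutral_cong_right)
        (auto simp: G_def p.emeasure_space_1[unfolded sp] subset_iff intro: less_SucI)
    finally show "emeasure P (prod_emb UNIV (\<lambda>_. p) J (Pi\<^sub>E J F)) = (\<Prod>j\<in>J. emeasure p (F j))" .
  qed
qed

text \<open>
  Recovers from the positions \<open>x\<^sub>n\<^sub>+\<^sub>1 = g(x\<^sub>n) + \<omega>\<^sub>n\<close> the pair of the letters \<open>\<omega>\<close> and the starting point.
\<close>

definition orbit_coding :: "('a::group_add \<Rightarrow> 'a) \<Rightarrow> (nat \<Rightarrow> 'a) \<Rightarrow> (nat \<Rightarrow> 'a) \<times> 'a" where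
  "orbit_coding g x = ((\<lambda>n. - g (x n) + x (Suc n)), x 0)"

lemma skew_product_orbit_coding:
  "skew_product (\<lambda>t x. g x + t) (orbit_coding g x) = orbit_coding g (shift x)"
  by (simp add: skew_product_def orbit_coding_def shift_def)

context
  fixes p :: "'a::{topological_group_add, second_countable_topology} measure" and g :: "'a \<Rightarrow> 'a"
  assumes haar: "normalized_haar p" and g: "g \<in> borel_measurable borel"
begin

interpretation p: prob_space p using haar by (rule haar_prob_space)

interpretation sequence_space p
  by (simp add: sequence_space_def product_prob_spaceI p.prob_space_axioms)

interpretation Sp: pair_prob_space S p ..

interpretation pp: pair_prob_space p p ..

lemmas sets_p[measurable_cong] = sets_haar[OF haar]
  and space_p = space_haar[OF haar]

lemmas [measurable] = g borel_measurable_uminus_group measurable_shift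

text \<open>
  Given the current position \<open>a\<close>, the next letter is \<open>- g(a) + s\<close> with \<open>s\<close> uniform, which is uniform by
  left invariance whatever \<open>a\<close> is.  So the first letter contributes the factor \<open>p(F\<^sub>0)\<close>, and
  the remaining ones are treated by the induction hypothesis with \<open>s\<close> as current position.
\<close>

lemma increments_cylinder:
  assumes "\<And>j. F j \<in> sets borel"
  shows "emeasure S {x. \<forall>j<n. - g (case_nat a x j) + x j \<in> F j} = (\<Prod>j<n. emeasure p (F j))"
  using assms
proof (induction n arbitrary: a F)
  case 0
  show ?case using P.emeasure_space_1 by (simp add: space_PiM space_p)
next
  case (Suc n)
  note [measurable] = Suc.prems
  define C where "C a F = {x. \<forall>j<n. - g (case_nat a x j) + x j \<in> F j}" for a and F :: "nat \<Rightarrow> 'a set"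
  have meas: "{x. \<forall>j<k. - g (case_nat a x j) + x j \<in> F j} \<in> sets S"
    if [measurable]: "\<And>j. F j \<in> sets borel" for a k and F :: "nat \<Rightarrow> 'a set"
  proof -
    have [measurable]: "(\<lambda>x. case_nat a x j) \<in> measurable S borel" for j by (cases j) auto
    have "{x \<in> space S. \<forall>j<k. - g (case_nat a x j) + x j \<in> F j} \<in> sets S" by measurable
    then show ?thesis by (simp add: space_PiM space_p)
  qed
  have split: "(\<forall>j<Suc n. - g (case_nat a (case_nat s w) j) + case_nat s w j \<in> F j) \<longleftrightarrow>
      - g a + s \<in> F 0 \<and> w \<in> C s (\<lambda>j. F (Suc j))" for s w
    unfolding C_def by (auto simp: less_Suc_eq_0_disj)
  have "emeasure S {x. \<forall>j<Suc n. - g (case_nat a x j) + x j \<in> F j} =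
      emeasure (distr (p \<Otimes>\<^sub>M S) S (\<lambda>(s, w). case_nat s w))
        {x. \<forall>j<Suc n. - g (case_nat a x j) + x j \<in> F j}"
    by (simp only: PiM_iter)
  also have "\<dots> = emeasure (p \<Otimes>\<^sub>M S) {(s, w). - g a + s \<in> F 0 \<and> w \<in> C s (\<lambda>j. F (Suc j))}"
  proof (subst emeasure_distr)
    have "(\<lambda>(s, w). case_nat s w) -` {x. \<forall>j<Suc n. - g (case_nat a x j) + x j \<in> F j} \<inter> space (p \<Otimes>\<^sub>M S)
      = {(s, w). - g a + s \<in> F 0 \<and> w \<in> C s (\<lambda>j. F (Suc j))}"
      using split by (auto simp: space_pair_measure space_PiM space_p)
    then show "emeasure (p \<Otimes>\<^sub>M S) ((\<lambda>(s, w). case_nat s w) -` {x. \<forall>j<Suc n. - g (case_nat a x j) + x j \<in> F j} \<inter> space (p \<Otimes>\<^sub>M S)) =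
      emeasure (p \<Otimes>\<^sub>M S) {(s, w). - g a + s \<in> F 0 \<and> w \<in> C s (\<lambda>j. F (Suc j))}" by simp
  qed (use meas[OF Suc.prems] in auto)
  also have "\<dots> = (\<integral>\<^sup>+s. indicator (F 0) (- g a + s) * (\<Prod>j<n. emeasure p (F (Suc j))) \<partial>p)"
  proof (subst P.emeasure_pair_measure_alt)
    have "{z \<in> space (p \<Otimes>\<^sub>M S). - g a + fst z \<in> F 0 \<and>
        (\<forall>j<n. - g (case_nat (fst z) (snd z) j) + snd z j \<in> F (Suc j))} \<in> sets (p \<Otimes>\<^sub>M S)"
    proof -
      have [measurable]: "(\<lambda>z. case_nat (fst z) (snd z) j) \<in> measurable (p \<Otimes>\<^sub>M S) borel" for j
        by (cases j) auto
      show ?thesis by measurable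
    qed
    also have "{z \<in> space (p \<Otimes>\<^sub>M S). - g a + fst z \<in> F 0 \<and>
        (\<forall>j<n. - g (case_nat (fst z) (snd z) j) + snd z j \<in> F (Suc j))} =
        {(s, w). - g a + s \<in> F 0 \<and> w \<in> C s (\<lambda>j. F (Suc j))}"
      by (auto simp: C_def space_pair_measure space_PiM space_p cong del: nat.case_cong_weak)
    finally show "{(s, w). - g a + s \<in> F 0 \<and> w \<in> C s (\<lambda>j. F (Suc j))} \<in> sets (p \<Otimes>\<^sub>M S)" .
    have "emeasure S (Pair s -` {(s, w). - g a + s \<in> F 0 \<and> w \<in> C s (\<lambda>j. F (Suc j))}) =
        indicator (F 0) (- g a + s) * (\<Prod>j<n. emeasure p (F (Suc j)))" for s
      using Suc.IH[of "\<lambda>j. F (Suc j)" s] Suc.prems by (auto simp: C_def indicator_def)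
    then show "(\<integral>\<^sup>+s. emeasure S (Pair s -` {(s, w). - g a + s \<in> F 0 \<and> w \<in> C s (\<lambda>j. F (Suc j))}) \<partial>p) =
        (\<integral>\<^sup>+s. indicator (F 0) (- g a + s) * (\<Prod>j<n. emeasure p (F (Suc j))) \<partial>p)" by simp
  qed
  also have "\<dots> = (\<integral>\<^sup>+s. indicator (F 0) s \<partial>distr p p (\<lambda>s. - g a + s)) * (\<Prod>j<n. emeasure p (F (Suc j)))"
    by (subst nn_integral_distr) (auto simp: nn_integral_multc)
  also have "\<dots> = emeasure p (F 0) * (\<Prod>j<n. emeasure p (F (Suc j)))"
    unfolding haar_left_distr[OF haar] by (simp add: sets_p)
  also have "\<dots> = (\<Prod>j<Suc n. emeasure p (F j))" by (rule prod.lessThan_Suc_shift[symmetric])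
  finally show ?case .
qed

lemma measurable_increments: "(\<lambda>x n. - g (case_nat a x n) + x n) \<in> measurable S S"
proof (rule measurable_PiM_single')
  fix i show "(\<lambda>x. - g (case_nat a x i) + x i) \<in> measurable S p" by (cases i) auto
qed (auto simp: space_PiM space_p)

lemma distr_increments: "distr S S (\<lambda>x n. - g (case_nat a x n) + x n) = S"
proof (rule PiM_eq)
  fix J F assume J: "finite J" "J \<subseteq> (UNIV :: nat set)" and F: "\<And>j. j \<in> J \<Longrightarrow> F j \<in> sets p"
  obtain n where n: "J \<subseteq> {..<n}" using J(1) finite_nat_iff_bounded by auto
  define G where "G i = (if i \<in> J then F i else UNIV)" for i
  have G: "G i \<in> sets borel" for i using F by (auto simp: G_def sets_p)
  have "(\<lambda>x n. - g (case_nat a x n) + x n) -` prod_emb UNIV (\<lambda>_. p) J (Pi\<^sub>E J F) \<inter> space S =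
      {x. \<forall>j<n. - g (case_nat a x j) + x j \<in> G j}"
    using n by (auto simp: prod_emb_def space_p space_PiM G_def PiE_iff subset_iff)
  then have "emeasure (distr S S (\<lambda>x n. - g (case_nat a x n) + x n)) (prod_emb UNIV (\<lambda>_. p) J (Pi\<^sub>E J F)) =
      (\<Prod>j<n. emeasure p (G j))"
    using J F increments_cylinder[OF G]
    by (subst emeasure_distr[OF measurable_increments]) (auto intro!: sets_PiM_I)
  also have "\<dots> = (\<Prod>j\<in>J. emeasure p (F j))"
    using n by (intro prod.mono_neutral_cong_right)
      (auto simp: G_def p.emeasure_space_1[unfolded space_p])
  finally show "emeasure (distr S S (\<lambda>x n. - g (case_nat a x n) + x n)) (prod_emb UNIV (\<lambda>_. p) J (Pi\<^sub>E J F)) =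
      (\<Prod>j\<in>J. emeasure p (F j))" .
qed simp

lemma measurable_orbit_coding[measurable]: "orbit_coding g \<in> measurable S (S \<Otimes>\<^sub>M p)"
proof -
  have "(\<lambda>x n. - g (x n) + x (Suc n)) \<in> measurable S S"
    by (rule measurable_PiM_single') (auto simp: space_PiM space_p)
  then show ?thesis unfolding orbit_coding_def[abs_def] by measurable
qed

text \<open>
  For every fixed starting point the letters are distributed like the positions
  (\<open>distr_increments\<close>), and this law not depending on the starting point makes them independent of
  it.
\<close>

lemma distr_orbit_coding: "distr S (S \<Otimes>\<^sub>M p) (orbit_coding g) = S \<Otimes>\<^sub>M p"
proof (rule measure_eqI)
  fix A assume "A \<in> sets (distr S (S \<Otimes>\<^sub>M p) (orbit_coding g))"
  then have A[measurable]: "A \<in> sets (S \<Otimes>\<^sub>M p)" by simp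
  have "emeasure (distr S (S \<Otimes>\<^sub>M p) (orbit_coding g)) A = (\<integral>\<^sup>+x. indicator A (orbit_coding g x) \<partial>S)"
    by (subst nn_integral_distr[symmetric, OF measurable_orbit_coding]) auto
  also have "\<dots> = (\<integral>\<^sup>+x. indicator A (orbit_coding g x) \<partial>distr (p \<Otimes>\<^sub>M S) S (\<lambda>(s, w). case_nat s w))"
    by (simp only: PiM_iter)
  also have "\<dots> = (\<integral>\<^sup>+z. indicator A (orbit_coding g (case_nat (fst z) (snd z))) \<partial>(p \<Otimes>\<^sub>M S))"
    by (subst nn_integral_distr) (auto simp: case_prod_beta)
  also have "\<dots> = (\<integral>\<^sup>+a. \<integral>\<^sup>+x. indicator A (orbit_coding g (case_nat a x)) \<partial>S \<partial>p)"
    by (subst P.nn_integral_fst[symmetric]) auto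
  also have "\<dots> = (\<integral>\<^sup>+a. \<integral>\<^sup>+\<omega>. indicator A (\<omega>, a) \<partial>S \<partial>p)"
  proof (rule nn_integral_cong)
    fix a
    have "(\<integral>\<^sup>+\<omega>. indicator A (\<omega>, a) \<partial>S) =
        (\<integral>\<^sup>+\<omega>. indicator A (\<omega>, a) \<partial>distr S S (\<lambda>x n. - g (case_nat a x n) + x n))"
      by (simp only: distr_increments)
    also have "\<dots> = (\<integral>\<^sup>+x. indicator A (orbit_coding g (case_nat a x)) \<partial>S)"
      by (subst nn_integral_distr[OF measurable_increments]) (auto simp: orbit_coding_def space_p)
    finally show "(\<integral>\<^sup>+x. indicator A (orbit_coding g (case_nat a x)) \<partial>S) = (\<integral>\<^sup>+\<omega>. indicator A (\<omega>, a) \<partial>S)" ..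
  qed
  also have "\<dots> = emeasure (S \<Otimes>\<^sub>M p) A"
    by (subst Sp.nn_integral_snd) auto
  finally show "emeasure (distr S (S \<Otimes>\<^sub>M p) (orbit_coding g)) A = emeasure (S \<Otimes>\<^sub>M p) A" .
qed simp

lemma measurable_skew_product: "skew_product (\<lambda>t x. g x + t) \<in> measurable (S \<Otimes>\<^sub>M p) (S \<Otimes>\<^sub>M p)"
  unfolding skew_product_def by measurable

text \<open>
  Invariance and ergodicity pass to factors, and \<open>orbit_coding g\<close> is a factor map from the Bernoulli
  shift.
\<close>

lemma ergodic_skew_product: "ergodic_prob (skew_product (\<lambda>t x. g x + t)) (S \<Otimes>\<^sub>M p)"
  unfolding ergodic_prob_def invariant_prob_def
proof (intro conjI ballI impI)
  let ?F = "skew_product (\<lambda>t x. g x + t)" and ?M = "S \<Otimes>\<^sub>M p"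
  note [measurable] = measurable_skew_product
  show "prob_space ?M" by (rule Sp.prob_space_axioms)
  show "?F \<in> measurable ?M ?M" by measurable
  have "distr ?M ?M ?F = distr (distr S ?M (orbit_coding g)) ?M ?F" by (simp only: distr_orbit_coding)
  also have "\<dots> = distr (distr S S shift) ?M (orbit_coding g)"
    by (simp add: distr_distr comp_def skew_product_orbit_coding)
  finally show "distr ?M ?M ?F = ?M" by (simp only: distr_shift distr_orbit_coding)
  fix A assume A[measurable]: "A \<in> sets ?M" and inv: "?F -` A \<inter> space ?M = A"
  define B where "B = orbit_coding g -` A \<inter> space S"
  have sM: "space ?M = UNIV" "space S = UNIV" by (simp_all add: space_pair_measure space_PiM space_p)
  have "shift -` B \<inter> space S = orbit_coding g -` (?F -` A \<inter> space ?M) \<inter> space S"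
    by (simp add: B_def sM set_eq_iff skew_product_orbit_coding)
  then have "shift -` B \<inter> space S = B" by (simp only: inv B_def)
  then have "measure S B = 0 \<or> measure S B = 1"
    by (intro shift_invariant_measure_0_1) (simp_all add: B_def)
  moreover have "measure ?M A = measure (distr S ?M (orbit_coding g)) A" by (simp only: distr_orbit_coding)
  then have "measure ?M A = measure S B" by (simp add: measure_distr B_def)
  ultimately show "measure ?M A = 0 \<or> measure ?M A = 1" by simp
qed

lemma markovian_skew_product: "markovian (\<lambda>t x. g x + t) S (S \<Otimes>\<^sub>M p)"
  unfolding markovian_def
proof (intro conjI exI)
  have sS: "sets S = sets path_algebra" by (intro sets_PiM_cong) (simp_all add: sets_p)
  show eq: "sets (S \<Otimes>\<^sub>M p) = sets (path_algebra \<Otimes>\<^sub>M borel)"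
    by (intro sets_pair_measure_cong sS sets_p)
  show "invariant_prob (skew_product (\<lambda>t x. g x + t)) (S \<Otimes>\<^sub>M p)"
    using ergodic_skew_product by (simp add: ergodic_prob_def)
  show "distr (S \<Otimes>\<^sub>M p) path_algebra fst = S"
    using p.distr_pair_fst[of S] distr_cong[OF refl sS[symmetric], of "S \<Otimes>\<^sub>M p" fst fst] by simp
  show "(\<lambda>_. p) \<in> measurable borel (prob_algebra borel)"
    by (intro measurable_const) (simp add: space_prob_algebra p.prob_space_axioms sets_p)
  show "\<forall>A\<in>sets (path_algebra \<Otimes>\<^sub>M borel).
      emeasure (S \<Otimes>\<^sub>M p) A = (\<integral>\<^sup>+\<omega>. emeasure p {x. (\<omega>, x) \<in> A} \<partial>S)"
    unfolding eq[symmetric] by (auto simp: p.emeasure_pair_measure_alt vimage_def)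
qed

lemma FPM_skew_product: "FPM (\<lambda>t x. g x + t) S p"
  unfolding FPM_def
proof (intro exI[of _ "1 :: nat"] exI[of _ "\<lambda>_. S \<Otimes>\<^sub>M p"] conjI allI impI ballI)
  let ?F = "skew_product (\<lambda>t x. g x + t)"
  fix \<phi> :: "(nat \<Rightarrow> 'a) \<times> 'a \<Rightarrow> real"
  assume \<phi>[measurable]: "\<phi> \<in> borel_measurable (S \<Otimes>\<^sub>M p)" and "\<exists>C. \<forall>z. \<bar>\<phi> z\<bar> \<le> C"
  then obtain C where C: "\<And>z. \<bar>\<phi> z\<bar> \<le> C" by auto
  note [measurable] = measurable_skew_product
  define a where "a n z = (\<Sum>j<n. \<phi> ((?F ^^ j) z)) / real n" for n z
  have [measurable]: "(?F ^^ j) \<in> measurable (S \<Otimes>\<^sub>M p) (S \<Otimes>\<^sub>M p)" for j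
    by (induction j) (simp_all add: measurable_ident_sets)
  have [measurable]: "a n \<in> borel_measurable (S \<Otimes>\<^sub>M p)" for n unfolding a_def by measurable
  have basin: "birkhoff_basin ?F (S \<Otimes>\<^sub>M p) \<phi> = {z \<in> space (S \<Otimes>\<^sub>M p).
      convergent (\<lambda>n. a n z) \<and> Lim sequentially (\<lambda>n. a n z) = (\<integral>z. \<phi> z \<partial>(S \<Otimes>\<^sub>M p))}"
    by (auto simp: birkhoff_basin_def a_def space_pair_measure space_PiM space_p
        convergent_LIMSEQ_iff limI convergentI)
  have "birkhoff_basin ?F (S \<Otimes>\<^sub>M p) \<phi> \<in> sets (S \<Otimes>\<^sub>M p)"
    unfolding basin Cauchy_convergent_iff[symmetric] by measurable
  moreover have "AE z in S \<Otimes>\<^sub>M p. z \<in> birkhoff_basin ?F (S \<Otimes>\<^sub>M p) \<phi>"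
    using ergodic_bounded_birkhoff[OF ergodic_skew_product \<phi> C] by (simp add: birkhoff_basin_def)
  ultimately show "emeasure (S \<Otimes>\<^sub>M p) (\<Union>i<1::nat. birkhoff_basin ?F (S \<Otimes>\<^sub>M p) \<phi>) = 1"
    by (simp add: Sp.emeasure_eq_1_AE lessThan_Suc)
qed (auto simp: ergodic_skew_product markovian_skew_product absolutely_continuous_def)

section \<open>The transition operator\<close>

text \<open>
  The value at \<open>(t, x)\<close> of the transition operator applied to \<open>\<phi>\<close>, for any \<open>t\<close>.
\<close>

definition fibre_mean :: "('a \<times> 'a \<Rightarrow> real) \<Rightarrow> 'a \<Rightarrow> real" where
  "fibre_mean \<phi> x = (\<integral>u. \<phi> (u, g x + u) \<partial>p)"

lemma fibre_mean_const: "fibre_mean (\<lambda>_. r) x = r"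
  by (simp add: fibre_mean_def p.prob_space)

abbreviation "transition \<equiv> kernel_op (hat_kernel (\<lambda>_. p) (\<lambda>t x. g x + t))"

lemma transition_eq:
  assumes [measurable]: "\<phi> \<in> borel_measurable (p \<Otimes>\<^sub>M p)"
  shows "transition \<phi> z = fibre_mean \<phi> (snd z)"
proof -
  have [measurable]: "\<phi> \<in> borel_measurable (borel \<Otimes>\<^sub>M borel)"
    using assms measurable_cong_sets[OF sets_pair_measure_cong[OF sets_p sets_p] refl, of borel] by simp
  show ?thesis
    by (cases z) (simp add: kernel_op_def hat_kernel_def fibre_mean_def integral_distr)
qed

lemma measurable_fibre_mean[measurable]:
  assumes [measurable]: "\<phi> \<in> borel_measurable (p \<Otimes>\<^sub>M p)"
  shows "fibre_mean \<phi> \<in> borel_measurable p"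
  unfolding fibre_mean_def[abs_def] by measurable

lemma measurable_transition:
  assumes [measurable]: "\<phi> \<in> borel_measurable (p \<Otimes>\<^sub>M p)"
  shows "transition \<phi> \<in> borel_measurable (p \<Otimes>\<^sub>M p)"
  unfolding transition_eq[OF assms, abs_def] by measurable

text \<open>
  The second application averages \<open>fibre_mean \<phi>\<close> over \<open>g(x) + u\<close>, whose law is \<open>p\<close> for every
  \<open>x\<close>.
\<close>

lemma transition_twice:
  assumes m: "\<phi> \<in> borel_measurable (p \<Otimes>\<^sub>M p)"
  shows "transition (transition \<phi>) = (\<lambda>_. \<integral>x. fibre_mean \<phi> x \<partial>p)"
proof
  fix z
  note [measurable] = m
  have "transition (transition \<phi>) z = (\<integral>u. fibre_mean \<phi> (g (snd z) + u) \<partial>p)"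
    by (simp add: transition_eq measurable_transition m fibre_mean_def[of "transition \<phi>"])
  also have "\<dots> = (\<integral>x. fibre_mean \<phi> x \<partial>distr p p (\<lambda>u. g (snd z) + u))"
    by (subst integral_distr) auto
  finally show "transition (transition \<phi>) z = (\<integral>x. fibre_mean \<phi> x \<partial>p)"
    by (simp only: haar_left_distr[OF haar])
qed

lemma AE_snd:
  assumes "AE x in p. R x"
  shows "AE z in p \<Otimes>\<^sub>M p. R (snd z)"
proof -
  obtain N where N: "{x \<in> space p. \<not> R x} \<subseteq> N" "N \<in> null_sets p"
    using assms by (auto elim!: AE_E simp: null_sets_def)
  have [measurable]: "N \<in> sets p" using N by auto
  have "AE x in p. x \<notin> N" using N(2) by (rule AE_not_in)
  then have "AE z in p \<Otimes>\<^sub>M p. snd z \<notin> N" by (intro pp.AE_pair_measure) auto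
  then show ?thesis using N(1) by (auto simp: space_p elim!: eventually_mono)
qed

context
  assumes nonsing: "\<And>N. N \<in> null_sets p \<Longrightarrow> g -` N \<in> null_sets p"
begin

text \<open>
  The map \<open>(x, u) \<mapsto> (u, g(x) + u)\<close> pulls null sets back to null sets: for fixed \<open>u\<close> it is \<open>g\<close> followed by a
  right translation, and both pull null sets back to null sets.  The conclusion, which is
  needed for almost every \<open>x\<close>, comes from exchanging the order of \<open>x\<close> and \<open>u\<close>.
\<close>

lemma AE_fibres:
  assumes "AE z in p \<Otimes>\<^sub>M p. R z"
  shows "AE x in p. AE u in p. R (u, g x + u)"
proof -
  obtain N where N: "{z \<in> space (p \<Otimes>\<^sub>M p). \<not> R z} \<subseteq> N" "N \<in> null_sets (p \<Otimes>\<^sub>M p)"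
    using assms by (auto elim!: AE_E simp: null_sets_def)
  have [measurable]: "N \<in> sets (p \<Otimes>\<^sub>M p)" using N by auto
  have "AE z in p \<Otimes>\<^sub>M p. z \<notin> N" using N(2) by (rule AE_not_in)
  then have "AE u in p. AE v in p. (u, v) \<notin> N" by (rule pp.AE_pair)
  then have "AE u in p. AE x in p. (u, g x + u) \<notin> N"
  proof eventually_elim
    case (elim u)
    define K where "K = {v. (u, v + u) \<in> N}"
    have add: "(\<lambda>v. v + u) \<in> measurable p p" by (rule haar_right_measurable[OF haar])
    have "AE v in distr p p (\<lambda>v. v + u). (u, v) \<notin> N" using elim by (simp only: haar_right_distr[OF haar])
    then have "AE v in p. v \<notin> K" using AE_distrD[OF add] by (simp add: K_def)
    moreover have "K \<in> sets p"
    proof -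
      have "(\<lambda>v. (u, v + u)) \<in> measurable p (p \<Otimes>\<^sub>M p)"
        by (rule measurable_compose[OF add measurable_Pair1']) (simp add: space_p)
      from measurable_sets[OF this \<open>N \<in> sets (p \<Otimes>\<^sub>M p)\<close>] show ?thesis
        by (simp add: K_def space_p vimage_def)
    qed
    ultimately have "K \<in> null_sets p" by (simp add: AE_iff_null_sets)
    then have "AE x in p. x \<notin> g -` K" by (intro AE_not_in nonsing)
    then show ?case by (simp add: K_def)
  qed
  then have "AE x in p. AE u in p. (u, g x + u) \<notin> N"
    by (subst pp.AE_commute) auto
  then show ?thesis
    using N(1) by (auto simp: space_pair_measure space_p elim!: eventually_mono)
qed

lemma Linf_fun_fibres:
  assumes "\<phi> \<in> Linf_fun (p \<Otimes>\<^sub>M p)" and C: "AE z in p \<Otimes>\<^sub>M p. \<bar>\<phi> z\<bar> \<le> C"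
  shows "AE x in p. integrable p (\<lambda>u. \<phi> (u, g x + u)) \<and> \<bar>fibre_mean \<phi> x\<bar> \<le> C"
  using AE_fibres[OF C]
proof eventually_elim
  case (elim x)
  have [measurable]: "\<phi> \<in> borel_measurable (p \<Otimes>\<^sub>M p)" using assms(1) by (simp add: Linf_fun_def)
  have int: "integrable p (\<lambda>u. \<phi> (u, g x + u))"
    using elim by (intro p.integrable_const_bound[where B=C]) auto
  have "\<bar>fibre_mean \<phi> x\<bar> \<le> (\<integral>u. \<bar>\<phi> (u, g x + u)\<bar> \<partial>p)"
    unfolding fibre_mean_def by (rule integral_abs_bound)
  also have "\<dots> \<le> C" using elim int by (intro p.integral_le_const) auto
  finally show ?case using int by simp
qed

lemma Linf_respects_transition: "Linf_respects (p \<Otimes>\<^sub>M p) transition"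
  unfolding Linf_respects_def
proof (intro allI impI)
  have fn: "transition \<phi> \<in> Linf_fun (p \<Otimes>\<^sub>M p)" if \<phi>: "\<phi> \<in> Linf_fun (p \<Otimes>\<^sub>M p)" for \<phi>
  proof -
    obtain C where C: "AE z in p \<Otimes>\<^sub>M p. \<bar>\<phi> z\<bar> \<le> C" and m: "\<phi> \<in> borel_measurable (p \<Otimes>\<^sub>M p)"
      using \<phi> by (auto simp: Linf_fun_def)
    have "AE z in p \<Otimes>\<^sub>M p. \<bar>transition \<phi> z\<bar> \<le> C"
      using AE_snd[OF Linf_fun_fibres[OF \<phi> C]]
      by eventually_elim (simp add: transition_eq[OF m])
    then show ?thesis using measurable_transition[OF m] by (auto simp: Linf_fun_def)
  qed
  fix \<phi> \<psi> assume "(\<phi>, \<psi>) \<in> Linf_rel (p \<Otimes>\<^sub>M p)"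
  then have l: "\<phi> \<in> Linf_fun (p \<Otimes>\<^sub>M p)" "\<psi> \<in> Linf_fun (p \<Otimes>\<^sub>M p)"
    and eq: "AE z in p \<Otimes>\<^sub>M p. \<phi> z = \<psi> z" by (auto simp: Linf_rel_def)
  then have m[measurable]: "\<phi> \<in> borel_measurable (p \<Otimes>\<^sub>M p)" "\<psi> \<in> borel_measurable (p \<Otimes>\<^sub>M p)"
    by (auto simp: Linf_fun_def)
  have "AE x in p. fibre_mean \<phi> x = fibre_mean \<psi> x"
    using AE_fibres[OF eq]
    by eventually_elim (auto simp: fibre_mean_def intro!: integral_cong_AE)
  from AE_snd[OF this] have "AE z in p \<Otimes>\<^sub>M p. transition \<phi> z = transition \<psi> z"
    by eventually_elim (simp add: transition_eq m)
  then show "(transition \<phi>, transition \<psi>) \<in> Linf_rel (p \<Otimes>\<^sub>M p)"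
    using l fn by (auto simp: Linf_rel_def)
qed

lemma Linf_linear_transition: "Linf_linear (p \<Otimes>\<^sub>M p) (Linf_lift (p \<Otimes>\<^sub>M p) transition)"
proof (rule Linf_linear_lift[OF Linf_respects_transition])
  fix \<phi> assume \<phi>: "\<phi> \<in> Linf_fun (p \<Otimes>\<^sub>M p)"
  then obtain C where C: "AE z in p \<Otimes>\<^sub>M p. \<bar>\<phi> z\<bar> \<le> C" and m[measurable]: "\<phi> \<in> borel_measurable (p \<Otimes>\<^sub>M p)"
    by (auto simp: Linf_fun_def)
  show "AE z in p \<Otimes>\<^sub>M p. transition (\<lambda>z. a * \<phi> z) z = a * transition \<phi> z" for a
    by (simp add: transition_eq m fibre_mean_def)
  fix \<psi> assume \<psi>: "\<psi> \<in> Linf_fun (p \<Otimes>\<^sub>M p)"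
  then obtain D where D: "AE z in p \<Otimes>\<^sub>M p. \<bar>\<psi> z\<bar> \<le> D" and m'[measurable]: "\<psi> \<in> borel_measurable (p \<Otimes>\<^sub>M p)"
    by (auto simp: Linf_fun_def)
  show "AE z in p \<Otimes>\<^sub>M p. transition (\<lambda>z. \<phi> z + \<psi> z) z = transition \<phi> z + transition \<psi> z"
    using AE_snd[OF Linf_fun_fibres[OF \<phi> C]] AE_snd[OF Linf_fun_fibres[OF \<psi> D]]
    by eventually_elim (simp add: transition_eq m m' fibre_mean_def)
qed

text \<open>
  A second pair of applications fixes the constant produced by the first pair, so the fourth power
  maps the class of \<open>\<phi>\<close> to the class of the mean of \<open>fibre_mean \<phi>\<close>, which is bounded by any
  essential bound of \<open>\<phi>\<close>.
\<close>

lemma Linf_compact_op_transition: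
  "Linf_compact_op (p \<Otimes>\<^sub>M p) (Linf_lift (p \<Otimes>\<^sub>M p) transition ^^ 4)"
proof (rule Linf_compact_op_constants)
  show "prob_space (p \<Otimes>\<^sub>M p)" by (rule pp.prob_space_axioms)
  show "Linf_linear (p \<Otimes>\<^sub>M p) (Linf_lift (p \<Otimes>\<^sub>M p) transition ^^ 4)"
    by (rule Linf_linear_funpow[OF Linf_linear_transition])
  fix \<phi> C assume \<phi>: "\<phi> \<in> Linf_fun (p \<Otimes>\<^sub>M p)" and C: "AE z in p \<Otimes>\<^sub>M p. \<bar>\<phi> z\<bar> \<le> C"
  have m[measurable]: "\<phi> \<in> borel_measurable (p \<Otimes>\<^sub>M p)" using \<phi> by (simp add: Linf_fun_def)
  define l where "l = (\<integral>x. fibre_mean \<phi> x \<partial>p)"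
  have ae: "AE x in p. \<bar>fibre_mean \<phi> x\<bar> \<le> C" using Linf_fun_fibres[OF \<phi> C] by eventually_elim simp
  then have int: "integrable p (fibre_mean \<phi>)" by (intro p.integrable_const_bound[where B=C]) auto
  have "\<bar>l\<bar> \<le> (\<integral>x. \<bar>fibre_mean \<phi> x\<bar> \<partial>p)" unfolding l_def by (rule integral_abs_bound)
  also have "\<dots> \<le> C" using ae int by (intro p.integral_le_const) auto
  finally have "\<bar>l\<bar> \<le> C" .
  moreover have "(Linf_lift (p \<Otimes>\<^sub>M p) transition ^^ 4) (Linf_class (p \<Otimes>\<^sub>M p) \<phi>) =
      Linf_class (p \<Otimes>\<^sub>M p) (transition (transition (transition (transition \<phi>))))"
    using \<phi> Linf_respects_fun[OF Linf_respects_transition]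
    by (simp add: numeral_eq_Suc Linf_lift_class[OF Linf_respects_transition])
  moreover have "transition (transition (transition (transition \<phi>))) = (\<lambda>_. l)"
    by (simp add: transition_twice fibre_mean_const p.prob_space l_def)
  ultimately show "\<exists>r. \<bar>r\<bar> \<le> C \<and> (Linf_lift (p \<Otimes>\<^sub>M p) transition ^^ 4) (Linf_class (p \<Otimes>\<^sub>M p) \<phi>) =
      Linf_class (p \<Otimes>\<^sub>M p) (\<lambda>_. r)"
    by auto
qed

end

end

section \<open>Random translations of a compact Lie group\<close>

theorem corollary4:
  fixes E :: "'e::euclidean_space set"
    and \<A> :: "('a::{topological_group_add, t2_space, second_countable_topology}, 'e) chart set"
    and p :: "'a measure"
    and Q :: "'a \<Rightarrow> 'a measure"
    and P :: "(nat \<Rightarrow> 'a) measure"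
    and f0 :: "'a \<Rightarrow> 'a"
    and f :: "'a \<Rightarrow> 'a \<Rightarrow> 'a"
    and Phat :: "('a \<times> 'a \<Rightarrow> real) set \<Rightarrow> ('a \<times> 'a \<Rightarrow> real) set"
  assumes "compact_lie_group E \<A>"
    and "normalized_haar p"
    and Q: "\<And>t. Q t = distr p borel (\<lambda>s. s + t)"
    and "markov_measure Q p P"
    and "C1_diffeomorphism E \<A> f0"
    and f: "\<And>t x. f t x = f0 x + t"
    and Phat: "Phat = Linf_lift (p \<Otimes>\<^sub>M p) (kernel_op (hat_kernel Q f))"
  shows "FPM f P p \<and>
    (Linf_respects (p \<Otimes>\<^sub>M p) (kernel_op (hat_kernel Q f)) \<and>
     Linf_eventually_compact (p \<Otimes>\<^sub>M p) Phat \<and>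
     Linf_compact_op (p \<Otimes>\<^sub>M p) (Phat ^^ 4))"
proof -
  note haar = assms(2) and diffeo = assms(5)
  have lie: "lie_group E \<A>" using assms(1) by (simp add: compact_lie_group_def)
  have "Q t = p" for t
    using distr_cong[OF refl sets_haar[OF haar, symmetric], of p "\<lambda>s. s + t" "\<lambda>s. s + t"]
      haar_right_distr[OF haar] by (simp add: Q)
  then have Q_eq: "Q = (\<lambda>_. p)" by auto
  have f_eq: "f = (\<lambda>t x. f0 x + t)" using f by auto
  have P_eq: "P = (\<Pi>\<^sub>M i\<in>UNIV. p)"
    by (rule markov_measure_iid[OF haar_prob_space[OF haar] sets_haar[OF haar] assms(4)[unfolded Q_eq]])
  have "continuous_on UNIV f0"
    using diffeo by (simp add: C1_diffeomorphism_def Ck_map_def)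
  then have f0: "f0 \<in> borel_measurable borel" by (rule borel_measurable_continuous_onI)
  note null = lie_group_C1_diffeomorphism_vimage_null[OF lie haar diffeo]
  note compact = Linf_compact_op_transition[OF haar f0 null]
  have "Linf_eventually_compact (p \<Otimes>\<^sub>M p) Phat"
    unfolding Linf_eventually_compact_def Phat Q_eq f_eq
    using Linf_linear_transition[OF haar f0 null] compact by (intro conjI exI[of _ 4]) simp_all
  then show ?thesis
    using FPM_skew_product[OF haar f0] Linf_respects_transition[OF haar f0 null] compact
    by (simp add: Phat Q_eq f_eq P_eq)
qed

end
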